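(* Let $G$ be a graph, and let $\mathcal I^{\max}(G)$ denote the set of stable sets of $G$ of size $\alpha(G)$. Then $$\tilde\nu\text{-rank}(G)\le \alpha(G)^2+2^{\alpha(G)}\,|\mathcal I^{\max}(G)|.$$
   Context: $\mathbb N=\{0,1,2,\dots\}$; graphs are finite and simple; $\alpha(G)$ is the maximum size of a stable (independent) set of $G$. $\mathcal S^n$ is the space of real symmetric $n\times n$ matrices. For $\beta\in\mathbb N^n$ put $|\beta|=\sum_i\beta_i$ and $x^\beta=x_1^{\beta_1}\cdots x_n^{\beta_n}$. For $n,r\in\mathbb N$: $\mathcal N_{n,r}$ is the set of homogeneous polynomials of degree $r$ in $x_1,\dots,x_n$ with nonnegative coefficients (including $0$); $\mathcal H_{n,r}$ is the cone of homogeneous polynomials of degree $r+2$ (including $0$) of the form $\sum_{\beta\in\mathbb N^n,\ |\beta|\in\{r,r+2\}}x^\beta\sigma_\beta$, where each $\sigma_\beta$ is a sum of squares of real polynomials of degree at most $r+2-|\beta|$. $\|p\|_1$ is the sum of the absolute values of the coefficients of $p$. Define $$\widetilde{\mathcal Q}_n^{(r)}=\{M\in\mathcal S^n:\ p\cdot x^TMx\in\mathcal H_{n,r}\text{ for some }p\in\mathcal N_{n,r}\text{ with }\|p\|_1=1\}.$$ For a graph $G$ on $n$ vertices with adjacency matrix $A_G$, with $I$ the identity and $J$ the all-ones $n\times n$ matrix, $\tilde\nu^{(r)}(G)=\min\{t\in\mathbb R: t(A_G+I)-J\in\widetilde{\mathcal Q}_n^{(r)}\}$, and $\tilde\nu\text{-rank}(G)=\min\{r\in\mathbb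 N:\tilde\nu^{(r)}(G)=\alpha(G)\}$ (equal to $+\infty$ if no such $r$ exists); the empty graph (no vertices) has $\tilde\nu\text{-rank}$ equal to $0$ by definition. *)

theory Defs
  imports
    "HOL-Library.Poly_Mapping"
    "HOL-Library.Extended_Nat"
    "Graph_Theory.Pair_Digraph"
begin

(* Real polynomials in commuting variables indexed by 'a: an exponent vector beta is a finitely
   supported map to nat, and a polynomial maps exponent vectors to coefficients (finitely many of
   them nonzero); multiplication is convolution. Everything below is relative to a finite set V of
   variables. For a graph, V is its vertex set; R[x_1,...,x_n] is the case V = {1..n}. *)

type_synonym 'a mpoly = "('a \<Rightarrow>\<^sub>0 nat) \<Rightarrow>\<^sub>0 real"

definition exponents :: "'a set \<Rightarrow> ('a \<Rightarrow>\<^sub>0 nat) set" where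
  "exponents V = {\<beta>. Poly_Mapping.keys \<beta> \<subseteq> V}"

definition abs_exp :: "('a \<Rightarrow>\<^sub>0 nat) \<Rightarrow> nat" where
  "abs_exp \<beta> = (\<Sum>i\<in>Poly_Mapping.keys \<beta>. Poly_Mapping.lookup \<beta> i)"

definition monomial :: "('a \<Rightarrow>\<^sub>0 nat) \<Rightarrow> 'a mpoly" where
  "monomial \<beta> = Poly_Mapping.single \<beta> 1"

definition var :: "'a \<Rightarrow> 'a mpoly" where
  "var i = monomial (Poly_Mapping.single i 1)"

definition const :: "real \<Rightarrow> 'a mpoly" where
  "const c = Poly_Mapping.single 0 c"

definition polys :: "'a set \<Rightarrow> 'a mpoly set" where
  "polys V = {p. Poly_Mapping.keys p \<subseteq> exponents V}"

definition degree_le :: "nat \<Rightarrow> 'a mpoly \<Rightarrow> bool" where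
  "degree_le d p \<longleftrightarrow> (\<forall>\<beta>\<in>Poly_Mapping.keys p. abs_exp \<beta> \<le> d)"

(* The zero polynomial is homogeneous of every degree. *)
definition homogeneous :: "nat \<Rightarrow> 'a mpoly \<Rightarrow> bool" where
  "homogeneous d p \<longleftrightarrow> (\<forall>\<beta>\<in>Poly_Mapping.keys p. abs_exp \<beta> = d)"

definition norm1 :: "'a mpoly \<Rightarrow> real" where
  "norm1 p = (\<Sum>\<beta>\<in>Poly_Mapping.keys p. \<bar>Poly_Mapping.lookup p \<beta>\<bar>)"

(* d bounds the degree of the polynomials that are squared. In H_cone, bounding the degree of the
   sum of squares instead would give the same cone, because homogeneity forces the parts of degree
   greater than r + 2 to cancel, and such leading parts are nonnegative on the positive orthant. *)
definition sos :: "'a set \<Rightarrow> nat \<Rightarrow> 'a mpoly set" where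
  "sos V d = {s. \<exists>qs. (\<forall>q\<in>set qs. q \<in> polys V \<and> degree_le d q) \<and> s = (\<Sum>q\<leftarrow>qs. q ^ 2)}"

definition N_cone :: "'a set \<Rightarrow> nat \<Rightarrow> 'a mpoly set" where
  "N_cone V r = {p \<in> polys V. homogeneous r p \<and> (\<forall>\<beta>. Poly_Mapping.lookup p \<beta> \<ge> 0)}"

lemma finite_exponents:
  assumes "finite V"
  shows "finite {\<beta> \<in> exponents V. abs_exp \<beta> \<in> {r, r + 2}}"
proof -
  let ?A = "{\<beta> \<in> exponents V. abs_exp \<beta> \<in> {r, r + 2}}"
  have "inj_on Poly_Mapping.lookup ?A"
    by (rule inj_onI) (simp add: poly_mapping.lookup_inject)
  moreover have "Poly_Mapping.lookup ` ?A
      \<subseteq> {f. \<forall>i. (i \<in> V \<longrightarrow> f i \<in> {..r + 2}) \<and> (i \<notin> V \<longrightarrow> f i = 0)}"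
  proof (rule image_subsetI)
    fix \<beta> :: "'a \<Rightarrow>\<^sub>0 nat"
    assume b: "\<beta> \<in> ?A"
    have le: "Poly_Mapping.lookup \<beta> i \<le> abs_exp \<beta>" for i
    proof (cases "i \<in> Poly_Mapping.keys \<beta>")
      case True
      then show ?thesis unfolding abs_exp_def by (intro member_le_sum) simp_all
    next
      case False
      then show ?thesis by (simp add: in_keys_iff)
    qed
    have "abs_exp \<beta> \<le> r + 2" using b by auto
    then have "Poly_Mapping.lookup \<beta> i \<le> r + 2" for i
      using le order_trans by blast
    moreover have "Poly_Mapping.lookup \<beta> i = 0" if "i \<notin> V" for i
      using b that by (metis (mono_tags, lifting) exponents_def in_keys_iff mem_Collect_eq subsetD)
    ultimately show "Poly_Mapping.lookup \<beta>
        \<in> {f. \<forall>i. (i \<in> V \<longrightarrow> f i \<in> {..r + 2}) \<and> (i \<notin> V \<longrightarrow> f i = 0)}"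
      by blast
  qed
  moreover have "finite {f. \<forall>i. (i \<in> V \<longrightarrow> f i \<in> {..r + 2}) \<and> (i \<notin> V \<longrightarrow> f i = (0::nat))}"
    by (rule finite_set_of_finite_funs[OF assms finite_atMost])
  ultimately show ?thesis
    by (meson finite_imageD finite_subset)
qed

(* The index set of the sum is finite by finite_exponents. Homogeneity of the whole sum is a
   separate requirement, as the individual polynomials sigma beta need not be homogeneous. *)
definition H_cone :: "'a set \<Rightarrow> nat \<Rightarrow> 'a mpoly set" where
  "H_cone V r = {h. homogeneous (r + 2) h \<and>
     (\<exists>\<sigma>. (\<forall>\<beta> \<in> exponents V. abs_exp \<beta> \<in> {r, r + 2} \<longrightarrow> \<sigma> \<beta> \<in> sos V (r + 2 - abs_exp \<beta>)) \<and>
          h = (\<Sum>\<beta> | \<beta> \<in> exponents V \<and> abs_exp \<beta> \<in> {r, r + 2}. monomial \<beta> * \<sigma> \<beta>))}"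

(* Matrices with rows and columns indexed by V; entries outside V x V play no role. *)

definition symmetric_on :: "'a set \<Rightarrow> ('a \<Rightarrow> 'a \<Rightarrow> real) \<Rightarrow> bool" where
  "symmetric_on V M \<longleftrightarrow> (\<forall>i\<in>V. \<forall>j\<in>V. M i j = M j i)"

definition quad_form :: "'a set \<Rightarrow> ('a \<Rightarrow> 'a \<Rightarrow> real) \<Rightarrow> 'a mpoly" where
  "quad_form V M = (\<Sum>i\<in>V. \<Sum>j\<in>V. const (M i j) * var i * var j)"

definition Q_tilde :: "'a set \<Rightarrow> nat \<Rightarrow> ('a \<Rightarrow> 'a \<Rightarrow> real) set" where
  "Q_tilde V r = {M. symmetric_on V M \<and>
     (\<exists>p \<in> N_cone V r. norm1 p = 1 \<and> p * quad_form V M \<in> H_cone V r)}"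

(* Finite simple graphs are rendered by the locale pair_graph (finite, symmetric, without loops):
   an edge {u,v} is represented by the two arcs (u,v) and (v,u). *)

definition adj_matrix :: "'a pair_pre_digraph \<Rightarrow> 'a \<Rightarrow> 'a \<Rightarrow> real" where
  "adj_matrix G i j = (if (i, j) \<in> parcs G then 1 else 0)"

definition identity_matrix :: "'a \<Rightarrow> 'a \<Rightarrow> real" where
  "identity_matrix i j = (if i = j then 1 else 0)"

definition all_ones_matrix :: "'a \<Rightarrow> 'a \<Rightarrow> real" where
  "all_ones_matrix i j = 1"

definition stable_sets :: "'a pair_pre_digraph \<Rightarrow> 'a set set" where
  "stable_sets G = {S. S \<subseteq> pverts G \<and> (\<forall>u\<in>S. \<forall>v\<in>S. (u, v) \<notin> parcs G)}"

definition stability_number :: "'a pair_pre_digraph \<Rightarrow> nat" where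
  "stability_number G = Max (card ` stable_sets G)"

definition max_stable_sets :: "'a pair_pre_digraph \<Rightarrow> 'a set set" where
  "max_stable_sets G = {S \<in> stable_sets G. card S = stability_number G}"

definition nu_feasible :: "nat \<Rightarrow> 'a pair_pre_digraph \<Rightarrow> real set" where
  "nu_feasible r G =
     {t. (\<lambda>i j. t * (adj_matrix G i j + identity_matrix i j) - all_ones_matrix i j)
           \<in> Q_tilde (pverts G) r}"

(* is_nu_tilde r G t says that the minimum defining nu~^(r)(G) is attained and equals t. It is a
   relation rather than a LEAST-term so that no value is assigned when there is no minimum. *)
definition is_nu_tilde :: "nat \<Rightarrow> 'a pair_pre_digraph \<Rightarrow> real \<Rightarrow> bool" where
  "is_nu_tilde r G t \<longleftrightarrow> t \<in> nu_feasible r G \<and> (\<forall>s \<in> nu_feasible r G. t \<le> s)"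

(* In enat, Inf of a nonempty set is its minimum and Inf {} = \<infinity>. *)
definition nu_tilde_rank :: "'a pair_pre_digraph \<Rightarrow> enat" where
  "nu_tilde_rank G =
     (if pverts G = {} then 0
      else Inf {enat r | r. is_nu_tilde r G (real (stability_number G))})"

end

theory Submission
  imports Defs
begin

text \<open>
  Write \<open>E\<close> for the relation ``adjacent or equal'', \<open>m\<close> for the sum of all variables, and
  \<open>Q\<^sub>E\<close> for the sum of \<open>x\<^sub>a x\<^sub>b\<close> over all ordered pairs with \<open>E a b\<close>. The matrix
  \<open>\<alpha>(A + I) - J\<close> has the quadratic form \<open>\<alpha> Q\<^sub>E - m\<^sup>2\<close>, and the task is to find a multiplier \<open>p\<close>
  of small degree that turns this form into a sum of nonnegative polynomials and of squares of
  linear forms with nonnegative multipliers. That no smaller value than \<open>\<alpha>\<close> is feasible follows by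
  evaluating near the indicator vector of a maximum stable set
  (\<open>nu_feasible_lower_bound\<close>).

  The multiplier imitates the random greedy algorithm for stable sets: given weights \<open>x\<close>, choose a
  vertex \<open>v\<close> among the remaining vertices \<open>R\<close> with probability proportional to \<open>x\<^sub>v\<close>, delete its
  closed neighbourhood, and repeat. In terms of graphs, the deleted neighbourhood becomes a clique
  that is not joined to the other vertices (\<open>isolate\<close>). On average this does not increase \<open>Q\<^sub>E\<close>,
  and it does so coefficient by coefficient: multiplying \<open>Q\<^sub>E\<close> by the linear form \<open>\<Sum>v\<in>R. x\<^sub>v\<close>
  gives \<open>\<Sum>v\<in>R. x\<^sub>v Q\<^bsub>E'\<^esub>\<close>, where \<open>E'\<close> isolates \<open>v\<close> in \<open>E\<close>, plus a polynomial with nonnegative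
  coefficients (\<open>isolate_step\<close>). The linear form depends only on the set \<open>T\<close> of vertices chosen
  so far, so one factor for each \<open>T\<close> serves all runs of the algorithm.

  Only those \<open>T\<close> that lie in a maximum stable set need such a factor, and there are at most
  \<open>2\<^sup>\<alpha>\<close> of them for each maximum stable set. As soon as \<open>T\<close> leaves this family, all stable sets of
  the current graph have at most \<open>\<alpha> - 1\<close> elements. Then \<open>\<alpha> Q\<^sub>E - m\<^sup>2\<close> is positive with room to
  spare, and Turan's inequality shows that multiplication by the power of \<open>m\<close> with exponent
  \<open>\<alpha>\<^sup>2\<close> makes all coefficients nonnegative (\<open>polya_motzkin_straus\<close>). If \<open>T\<close> becomes a maximum
  stable set, then the current graph is a disjoint union of \<open>\<alpha>\<close> cliques, and \<open>\<alpha> Q\<^sub>E - m\<^sup>2\<close> is a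
  sum of squares of differences of their linear sums (\<open>clique_partition_certified\<close>). The induction
  over these cases is \<open>greedy_certificate\<close>.
\<close>

section \<open>Homogeneous polynomials and evaluation\<close>

lemma abs_exp_eq_sum:
  assumes "finite A" "Poly_Mapping.keys \<beta> \<subseteq> A"
  shows "abs_exp \<beta> = (\<Sum>i\<in>A. Poly_Mapping.lookup \<beta> i)"
  unfolding abs_exp_def
  by (rule sum.mono_neutral_left) (use assms in \<open>auto simp: in_keys_iff\<close>)

lemma abs_exp_add: "abs_exp (\<beta> + \<gamma>) = abs_exp \<beta> + abs_exp \<gamma>"
proof -
  let ?A = "Poly_Mapping.keys \<beta> \<union> Poly_Mapping.keys \<gamma>"
  have "finite ?A" by simp
  moreover have "Poly_Mapping.keys (\<beta> + \<gamma>) \<subseteq> ?A" by (rule keys_add)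
  ultimately show ?thesis
    using abs_exp_eq_sum[of ?A "\<beta> + \<gamma>"] abs_exp_eq_sum[of ?A \<beta>] abs_exp_eq_sum[of ?A \<gamma>]
    by (simp add: lookup_add sum.distrib)
qed

lemma abs_exp_zero [simp]: "abs_exp 0 = 0"
  and abs_exp_single [simp]: "abs_exp (Poly_Mapping.single i k) = k"
  by (simp_all add: abs_exp_def)

lemma exponents_add: "\<beta> \<in> exponents V \<Longrightarrow> \<gamma> \<in> exponents V \<Longrightarrow> \<beta> + \<gamma> \<in> exponents V"
  using keys_add[of \<beta> \<gamma>] by (auto simp: exponents_def)

lemma eq_sum_single_keys:
  fixes p :: "'a \<Rightarrow>\<^sub>0 'b::comm_monoid_add"
  shows "p = (\<Sum>\<beta>\<in>Poly_Mapping.keys p. Poly_Mapping.single \<beta> (Poly_Mapping.lookup p \<beta>))"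
  by (rule poly_mapping_eqI) (auto simp: lookup_sum lookup_single when_def in_keys_iff)

definition forms :: "'a set \<Rightarrow> nat \<Rightarrow> 'a mpoly set" where
  "forms V d = {p \<in> polys V. homogeneous d p}"

lemma forms_iff: "p \<in> forms V d \<longleftrightarrow> (\<forall>\<beta>\<in>Poly_Mapping.keys p. \<beta> \<in> exponents V \<and> abs_exp \<beta> = d)"
  by (auto simp: forms_def polys_def homogeneous_def)

lemma forms_zero [simp]: "0 \<in> forms V d"
  by (simp add: forms_iff)

lemma forms_add: "p \<in> forms V d \<Longrightarrow> q \<in> forms V d \<Longrightarrow> p + q \<in> forms V d"
  using keys_add[of p q] unfolding forms_iff by blast

lemma forms_diff: "p \<in> forms V d \<Longrightarrow> q \<in> forms V d \<Longrightarrow> p - q \<in> forms V d"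
  using keys_diff[of p q] unfolding forms_iff by blast

lemma forms_mult:
  assumes "p \<in> forms V d" "q \<in> forms V e"
  shows "p * q \<in> forms V (d + e)"
  unfolding forms_iff
proof
  fix \<beta> assume "\<beta> \<in> Poly_Mapping.keys (p * q)"
  then obtain a b where "\<beta> = a + b" "a \<in> Poly_Mapping.keys p" "b \<in> Poly_Mapping.keys q"
    using keys_mult[of p q] by blast
  then show "\<beta> \<in> exponents V \<and> abs_exp \<beta> = d + e"
    using assms by (auto simp: forms_iff abs_exp_add intro: exponents_add)
qed

lemma forms_var: "i \<in> V \<Longrightarrow> var i \<in> forms V 1"
  by (simp add: forms_iff var_def monomial_def exponents_def)

lemma forms_const: "const c \<in> forms V 0"
  by (simp add: forms_iff const_def exponents_def)

lemma const_add: "const (a + b) = const a + const b"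
  and const_mult: "const (a * b) = const a * const b"
  and const_diff: "const (a - b) = const a - const b"
  and const_0 [simp]: "const 0 = 0"
  and const_1 [simp]: "const 1 = 1"
  by (simp_all add: const_def single_add single_diff mult_single)

lemma const_of_nat: "const (of_nat n) = of_nat n"
  by (induction n) (simp_all add: const_add)

lemma const_sum: "const (\<Sum>i\<in>I. f i) = (\<Sum>i\<in>I. const (f i))"
  by (induction I rule: infinite_finite_induct) (simp_all add: const_add)

lemma N_cone_iff: "p \<in> N_cone V d \<longleftrightarrow> p \<in> forms V d \<and> (\<forall>\<beta>. Poly_Mapping.lookup p \<beta> \<ge> 0)"
  by (auto simp: N_cone_def forms_def)

lemma N_cone_zero [simp]: "0 \<in> N_cone V d"
  by (simp add: N_cone_iff)

lemma N_cone_add: "p \<in> N_cone V d \<Longrightarrow> q \<in> N_cone V d \<Longrightarrow> p + q \<in> N_cone V d"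
  by (simp add: N_cone_iff forms_add lookup_add)

lemma N_cone_sum: "(\<And>i. i \<in> I \<Longrightarrow> f i \<in> N_cone V d) \<Longrightarrow> (\<Sum>i\<in>I. f i) \<in> N_cone V d"
  by (induction I rule: infinite_finite_induct) (auto intro: N_cone_add)

lemma N_cone_const: "c \<ge> 0 \<Longrightarrow> const c \<in> N_cone V 0"
  by (simp add: N_cone_iff forms_const) (simp add: const_def lookup_single when_def)

lemma N_cone_var: "i \<in> V \<Longrightarrow> var i \<in> N_cone V 1"
  unfolding N_cone_iff using forms_var by (simp add: var_def monomial_def lookup_single when_def)

lemma N_cone_mult:
  assumes "p \<in> N_cone V d" "q \<in> N_cone V e"
  shows "p * q \<in> N_cone V (d + e)"
proof -
  have "p * q = (\<Sum>\<beta>\<in>Poly_Mapping.keys p. \<Sum>\<gamma>\<in>Poly_Mapping.keys q.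
      Poly_Mapping.single (\<beta> + \<gamma>) (Poly_Mapping.lookup p \<beta> * Poly_Mapping.lookup q \<gamma>))"
    by (subst (1) eq_sum_single_keys[of p], subst (1) eq_sum_single_keys[of q])
      (simp add: sum_product mult_single)
  then have "Poly_Mapping.lookup (p * q) \<delta> \<ge> 0" for \<delta>
    using assms by (auto simp: lookup_sum lookup_single when_def N_cone_iff intro!: sum_nonneg)
  then show ?thesis
    using assms forms_mult by (auto simp: N_cone_iff)
qed

lemma N_cone_one: "1 \<in> N_cone V 0"
  using N_cone_const[of 1] by simp

lemma N_cone_prod:
  "(\<And>i. i \<in> I \<Longrightarrow> f i \<in> N_cone V (d i)) \<Longrightarrow> (\<Prod>i\<in>I. f i) \<in> N_cone V (\<Sum>i\<in>I. d i)"
  by (induction I rule: infinite_finite_induct) (auto intro: N_cone_mult simp: N_cone_one)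

lemma N_cone_power: "p \<in> N_cone V d \<Longrightarrow> p ^ k \<in> N_cone V (k * d)"
  using N_cone_prod[of "{..<k}" "\<lambda>_. p" V "\<lambda>_. d"] by simp

lemma N_cone_const_mult: "c \<ge> 0 \<Longrightarrow> p \<in> N_cone V d \<Longrightarrow> const c * p \<in> N_cone V d"
  using N_cone_mult[OF N_cone_const, of c p V d] by simp

lemma N_cone_const_cancel:
  assumes "c > 0" "const c * p \<in> N_cone V d"
  shows "p \<in> N_cone V d"
proof -
  have "const (1 / c) * (const c * p) = p"
    using assms(1) by (simp flip: mult.assoc const_mult)
  then show ?thesis
    using N_cone_const_mult[OF _ assms(2), of "1 / c"] assms(1) by simp
qed

definition eval :: "('a \<Rightarrow> real) \<Rightarrow> 'a mpoly \<Rightarrow> real" where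
  "eval x p = (\<Sum>\<beta>\<in>Poly_Mapping.keys p.
     Poly_Mapping.lookup p \<beta> * (\<Prod>i\<in>Poly_Mapping.keys \<beta>. x i ^ Poly_Mapping.lookup \<beta> i))"

lemma eval_single:
  "eval x (Poly_Mapping.single \<beta> c) = c * (\<Prod>i\<in>Poly_Mapping.keys \<beta>. x i ^ Poly_Mapping.lookup \<beta> i)"
  by (simp add: eval_def)

lemma eval_zero [simp]: "eval x 0 = 0"
  by (simp add: eval_def)

lemma eval_add: "eval x (p + q) = eval x p + eval x q"
  unfolding eval_def by (rule setsum_keys_plus_distrib) (simp_all add: algebra_simps)

lemma eval_sum: "eval x (\<Sum>i\<in>I. f i) = (\<Sum>i\<in>I. eval x (f i))"
  by (induction I rule: infinite_finite_induct) (simp_all add: eval_add)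

lemma eval_mult_single:
  fixes \<beta> \<gamma> :: "'a \<Rightarrow>\<^sub>0 nat"
  shows "eval x (Poly_Mapping.single \<beta> c * Poly_Mapping.single \<gamma> d) =
    eval x (Poly_Mapping.single \<beta> c) * eval x (Poly_Mapping.single \<gamma> d)"
proof -
  let ?A = "Poly_Mapping.keys \<beta> \<union> Poly_Mapping.keys \<gamma>"
  have mon: "(\<Prod>i\<in>Poly_Mapping.keys \<delta>. x i ^ Poly_Mapping.lookup \<delta> i) =
      (\<Prod>i\<in>?A. x i ^ Poly_Mapping.lookup \<delta> i)" if "Poly_Mapping.keys \<delta> \<subseteq> ?A" for \<delta> :: "'a \<Rightarrow>\<^sub>0 nat"
    by (rule prod.mono_neutral_left) (use that in \<open>auto simp: in_keys_iff\<close>)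
  have "(\<Prod>i\<in>Poly_Mapping.keys (\<beta> + \<gamma>). x i ^ Poly_Mapping.lookup (\<beta> + \<gamma>) i) =
      (\<Prod>i\<in>Poly_Mapping.keys \<beta>. x i ^ Poly_Mapping.lookup \<beta> i) *
      (\<Prod>i\<in>Poly_Mapping.keys \<gamma>. x i ^ Poly_Mapping.lookup \<gamma> i)"
    unfolding mon[OF keys_add] mon[OF Un_upper1] mon[OF Un_upper2]
    by (simp only: lookup_add power_add prod.distrib)
  then show ?thesis
    by (simp add: mult_single eval_single)
qed

lemma eval_mult: "eval x (p * q) = eval x p * eval x q"
proof -
  have "eval x (p * q) = (\<Sum>\<beta>\<in>Poly_Mapping.keys p. \<Sum>\<gamma>\<in>Poly_Mapping.keys q.
      eval x (Poly_Mapping.single \<beta> (Poly_Mapping.lookup p \<beta>)) *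
      eval x (Poly_Mapping.single \<gamma> (Poly_Mapping.lookup q \<gamma>)))"
    by (subst (1) eq_sum_single_keys[of p], subst (1) eq_sum_single_keys[of q])
      (simp add: sum_product eval_sum eval_mult_single)
  also have "\<dots> = eval x p * eval x q"
    by (simp add: eval_def[of x p] eval_def[of x q] sum_product eval_single)
  finally show ?thesis .
qed

lemma eval_const [simp]: "eval x (const c) = c"
  by (simp add: const_def eval_single)

lemma eval_one [simp]: "eval x 1 = 1"
  using eval_const[of x 1] by simp

lemma eval_var [simp]: "eval x (var i) = x i"
  by (simp add: var_def monomial_def eval_single)

lemma eval_prod: "eval x (\<Prod>i\<in>I. f i) = (\<Prod>i\<in>I. eval x (f i))"
  by (induction I rule: infinite_finite_induct) (simp_all add: eval_mult)

lemma eval_power: "eval x (p ^ k) = eval x p ^ k"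
  by (induction k) (simp_all add: eval_mult)

lemma eval_N_cone_pos:
  assumes "p \<in> N_cone V d" "p \<noteq> 0" "\<And>i. i \<in> V \<Longrightarrow> x i > 0"
  shows "eval x p > 0"
  unfolding eval_def
proof (rule sum_pos)
  show "Poly_Mapping.keys p \<noteq> {}" using assms(2) by simp
  fix \<beta> assume \<beta>: "\<beta> \<in> Poly_Mapping.keys p"
  then have "Poly_Mapping.lookup p \<beta> > 0"
    using assms(1) by (auto simp: N_cone_iff in_keys_iff order_less_le)
  moreover have "(\<Prod>i\<in>Poly_Mapping.keys \<beta>. x i ^ Poly_Mapping.lookup \<beta> i) > 0"
    using \<beta> assms(1,3) by (intro prod_pos) (auto simp: N_cone_iff forms_iff exponents_def intro!: zero_less_power)
  ultimately show "Poly_Mapping.lookup p \<beta> * (\<Prod>i\<in>Poly_Mapping.keys \<beta>. x i ^ Poly_Mapping.lookup \<beta> i) > 0"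
    by simp
qed simp

lemma norm1_eq_eval_one:
  assumes "p \<in> N_cone V d"
  shows "norm1 p = eval (\<lambda>_. 1) p"
  using assms by (simp add: norm1_def eval_def N_cone_iff)

section \<open>Sums of squares with nonnegative multipliers\<close>

text \<open>
  For finite \<open>V\<close>, certified polynomials lie in \<open>H_cone V r\<close> (\<open>certified_imp_H_cone\<close>). Allowing an arbitrary
  nonnegative form as the multiplier of a square, instead of a monomial, makes it evident that
  multiplication by nonnegative forms preserves the property.
\<close>

inductive certified :: "'a set \<Rightarrow> nat \<Rightarrow> 'a mpoly \<Rightarrow> bool" for V r where
  certified_nonneg: "p \<in> N_cone V (r + 2) \<Longrightarrow> certified V r p"
| certified_square: "p \<in> N_cone V r \<Longrightarrow> l \<in> forms V 1 \<Longrightarrow> certified V r (p * l ^ 2)"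
| certified_add: "certified V r p \<Longrightarrow> certified V r q \<Longrightarrow> certified V r (p + q)"

lemma certified_sum: "(\<And>i. i \<in> I \<Longrightarrow> certified V r (f i)) \<Longrightarrow> certified V r (\<Sum>i\<in>I. f i)"
  by (induction I rule: infinite_finite_induct)
    (auto intro: certified_add certified_nonneg)

lemma certified_mult:
  assumes "q \<in> N_cone V s" "certified V r p"
  shows "certified V (s + r) (q * p)"
  using assms(2)
proof induction
  case (certified_nonneg p)
  then show ?case
    using N_cone_mult[OF assms(1), of p "r + 2"] by (intro certified.certified_nonneg) (simp add: add.assoc)
next
  case (certified_square p l)
  then show ?case
    using certified.certified_square[OF N_cone_mult[OF assms(1)], of p r l] by (simp add: mult.assoc)
next
  case (certified_add p q)
  then show ?case by (simp add: distrib_left certified.certified_add)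
qed

lemma sos_zero: "0 \<in> sos V d"
  by (auto simp: sos_def intro: exI[of _ "[]"])

lemma sos_add: "s \<in> sos V d \<Longrightarrow> t \<in> sos V d \<Longrightarrow> s + t \<in> sos V d"
proof -
  assume "s \<in> sos V d" "t \<in> sos V d"
  then obtain ps qs where "\<forall>q\<in>set ps. q \<in> polys V \<and> degree_le d q" "s = (\<Sum>q\<leftarrow>ps. q ^ 2)"
    "\<forall>q\<in>set qs. q \<in> polys V \<and> degree_le d q" "t = (\<Sum>q\<leftarrow>qs. q ^ 2)"
    unfolding sos_def by blast
  then show ?thesis by (auto simp: sos_def intro!: exI[of _ "ps @ qs"])
qed

lemma sos_square: "q \<in> forms V e \<Longrightarrow> e \<le> d \<Longrightarrow> q ^ 2 \<in> sos V d"
  by (auto simp: sos_def forms_def degree_le_def homogeneous_def intro!: exI[of _ "[q]"])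

lemma H_cone_zero: "0 \<in> H_cone V r"
  by (auto simp: H_cone_def homogeneous_def sos_zero intro!: exI[of _ "\<lambda>_. 0"])

lemma H_cone_add:
  assumes "g \<in> H_cone V r" "h \<in> H_cone V r"
  shows "g + h \<in> H_cone V r"
proof -
  let ?B = "{\<beta>. \<beta> \<in> exponents V \<and> abs_exp \<beta> \<in> {r, r + 2}}"
  obtain \<sigma> where \<sigma>: "\<forall>\<beta> \<in> exponents V. abs_exp \<beta> \<in> {r, r + 2} \<longrightarrow> \<sigma> \<beta> \<in> sos V (r + 2 - abs_exp \<beta>)"
    "g = (\<Sum>\<beta>\<in>?B. monomial \<beta> * \<sigma> \<beta>)"
    using assms(1) unfolding H_cone_def by blast
  obtain \<tau> where \<tau>: "\<forall>\<beta> \<in> exponents V. abs_exp \<beta> \<in> {r, r + 2} \<longrightarrow> \<tau> \<beta> \<in> sos V (r + 2 - abs_exp \<beta>)"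
    "h = (\<Sum>\<beta>\<in>?B. monomial \<beta> * \<tau> \<beta>)"
    using assms(2) unfolding H_cone_def by blast
  have "homogeneous (r + 2) (g + h)"
    using assms keys_add[of g h] unfolding H_cone_def homogeneous_def by blast
  moreover have "g + h = (\<Sum>\<beta>\<in>?B. monomial \<beta> * (\<sigma> \<beta> + \<tau> \<beta>))"
    by (simp add: \<sigma>(2) \<tau>(2) distrib_left sum.distrib)
  moreover have "\<forall>\<beta> \<in> exponents V. abs_exp \<beta> \<in> {r, r + 2} \<longrightarrow> \<sigma> \<beta> + \<tau> \<beta> \<in> sos V (r + 2 - abs_exp \<beta>)"
    using \<sigma>(1) \<tau>(1) sos_add by blast
  ultimately show ?thesis
    unfolding H_cone_def by (intro CollectI conjI exI[of _ "\<lambda>\<beta>. \<sigma> \<beta> + \<tau> \<beta>"]) auto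
qed

lemma H_cone_sum: "(\<And>i. i \<in> I \<Longrightarrow> f i \<in> H_cone V r) \<Longrightarrow> (\<Sum>i\<in>I. f i) \<in> H_cone V r"
  by (induction I rule: infinite_finite_induct) (auto intro: H_cone_add H_cone_zero)

text \<open>
  A single monomial suffices as support of the family of sums of squares. The nonnegative
  coefficient is moved into the square by its square root, and \<open>e\<close> is \<open>1\<close> or \<open>0\<close> according to the
  degree of the monomial.
\<close>

lemma monomial_square_in_H_cone:
  assumes V: "finite V" and \<beta>: "\<beta> \<in> exponents V" "abs_exp \<beta> \<in> {r, r + 2}"
    and q: "q \<in> forms V e" and deg: "abs_exp \<beta> + 2 * e = r + 2" and c: "c \<ge> 0"
  shows "Poly_Mapping.single \<beta> c * q ^ 2 \<in> H_cone V r"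
proof -
  let ?s = "(const (sqrt c) * q) ^ 2"
  let ?\<sigma> = "\<lambda>\<gamma>. if \<gamma> = \<beta> then ?s else 0"
  have sq: "const (sqrt c) * q \<in> forms V e"
    using forms_mult[OF forms_const q, of "sqrt c"] by simp
  have "const (sqrt c) ^ 2 = (const c :: 'a mpoly)"
    using c by (simp add: power2_eq_square flip: const_mult)
  moreover have "Poly_Mapping.single \<beta> c = monomial \<beta> * const c"
    by (simp add: monomial_def const_def mult_single)
  ultimately have *: "Poly_Mapping.single \<beta> c * q ^ 2 = monomial \<beta> * ?s"
    by (simp add: power_mult_distrib mult.assoc)
  have "Poly_Mapping.single \<beta> c \<in> forms V (abs_exp \<beta>)"
    using \<beta> by (simp add: forms_iff)
  then have "Poly_Mapping.single \<beta> c * q ^ 2 \<in> forms V (r + 2)"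
    using forms_mult[OF _ forms_mult[OF q q], of _ "abs_exp \<beta>"] deg
    by (simp add: power2_eq_square mult_2)
  then have "homogeneous (r + 2) (Poly_Mapping.single \<beta> c * q ^ 2)"
    by (simp add: forms_def)
  moreover have "\<forall>\<gamma> \<in> exponents V. abs_exp \<gamma> \<in> {r, r + 2} \<longrightarrow> ?\<sigma> \<gamma> \<in> sos V (r + 2 - abs_exp \<gamma>)"
    using sos_square[OF sq, of "r + 2 - abs_exp \<beta>"] deg by (auto intro: sos_zero)
  moreover have "(\<Sum>\<gamma> | \<gamma> \<in> exponents V \<and> abs_exp \<gamma> \<in> {r, r + 2}. monomial \<gamma> * ?\<sigma> \<gamma>) = monomial \<beta> * ?s"
    using \<beta> finite_exponents[OF V, of r] by (subst sum.remove[of _ \<beta>]) auto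
  ultimately show ?thesis
    unfolding H_cone_def using * by (intro CollectI conjI exI[of _ ?\<sigma>]) auto
qed

lemma certified_imp_H_cone:
  assumes V: "finite V" and "certified V r p"
  shows "p \<in> H_cone V r"
  using assms(2)
proof induction
  case (certified_nonneg p)
  have "Poly_Mapping.single \<beta> (Poly_Mapping.lookup p \<beta>) * 1 ^ 2 \<in> H_cone V r"
    if "\<beta> \<in> Poly_Mapping.keys p" for \<beta>
    by (rule monomial_square_in_H_cone[where e = 0])
      (use V that certified_nonneg forms_const[of 1 V] in \<open>auto simp: N_cone_iff forms_iff\<close>)
  then show ?case
    by (subst eq_sum_single_keys[of p]) (rule H_cone_sum, simp)
next
  case (certified_square p l)
  have "Poly_Mapping.single \<beta> (Poly_Mapping.lookup p \<beta>) * l ^ 2 \<in> H_cone V r"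
    if "\<beta> \<in> Poly_Mapping.keys p" for \<beta>
    by (rule monomial_square_in_H_cone[where e = 1])
      (use V that certified_square in \<open>auto simp: N_cone_iff forms_iff\<close>)
  then show ?case
    by (subst eq_sum_single_keys[of p], subst sum_distrib_right) (rule H_cone_sum, simp)
next
  case (certified_add p q)
  then show ?case by (simp add: H_cone_add)
qed

lemma eval_H_cone_nonneg:
  assumes "h \<in> H_cone V r" "\<And>i. i \<in> V \<Longrightarrow> x i \<ge> 0"
  shows "eval x h \<ge> 0"
proof -
  obtain \<sigma> where \<sigma>: "\<forall>\<beta> \<in> exponents V. abs_exp \<beta> \<in> {r, r + 2} \<longrightarrow> \<sigma> \<beta> \<in> sos V (r + 2 - abs_exp \<beta>)"
    "h = (\<Sum>\<beta> | \<beta> \<in> exponents V \<and> abs_exp \<beta> \<in> {r, r + 2}. monomial \<beta> * \<sigma> \<beta>)"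
    using assms(1) unfolding H_cone_def by blast
  have sos_nonneg: "eval x s \<ge> 0" if "s \<in> sos V d" for s :: "'a mpoly" and d
  proof -
    have "eval x (\<Sum>q\<leftarrow>qs. q ^ 2) \<ge> 0" for qs :: "'a mpoly list"
      by (induction qs) (simp_all add: eval_add eval_power)
    then show ?thesis using that by (auto simp: sos_def)
  qed
  have mon_nonneg: "eval x (monomial \<beta>) \<ge> 0" if "\<beta> \<in> exponents V" for \<beta>
    using that assms(2)
    by (auto simp: monomial_def eval_single exponents_def intro!: prod_nonneg zero_le_power)
  show ?thesis
    unfolding \<sigma>(2) eval_sum eval_mult
    by (intro sum_nonneg mult_nonneg_nonneg) (use \<sigma>(1) sos_nonneg mon_nonneg in blast)+
qed

section \<open>Motzkin-Straus forms of graphs\<close>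

definition linear_sum :: "'a set \<Rightarrow> 'a mpoly" where
  "linear_sum A = (\<Sum>i\<in>A. var i)"

definition edge_form :: "'a set \<Rightarrow> ('a \<Rightarrow> 'a \<Rightarrow> bool) \<Rightarrow> 'a mpoly" where
  "edge_form V E = (\<Sum>a\<in>V. \<Sum>b\<in>V. const (of_bool (E a b)) * (var a * var b))"

lemma edge_form_cong: "(\<And>a b. a \<in> W \<Longrightarrow> b \<in> W \<Longrightarrow> F a b = F' a b) \<Longrightarrow> edge_form W F = edge_form W F'"
  unfolding edge_form_def by (intro sum.cong refl) auto

lemma linear_sum_N_cone: "A \<subseteq> V \<Longrightarrow> linear_sum A \<in> N_cone V 1"
  unfolding linear_sum_def by (intro N_cone_sum N_cone_var) auto

lemma linear_sum_forms: "A \<subseteq> V \<Longrightarrow> linear_sum A \<in> forms V 1"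
  using linear_sum_N_cone unfolding N_cone_iff by blast

definition independent_in :: "('a \<Rightarrow> 'a \<Rightarrow> bool) \<Rightarrow> 'a set \<Rightarrow> bool" where
  "independent_in E U \<longleftrightarrow> pairwise (\<lambda>u v. \<not> E u v) U"

text \<open>
  Choose a point of \<open>I\<close> with the smallest closed neighbourhood, of size \<open>\<delta>\<close>, and remove this
  neighbourhood. Independent sets of the rest extend by the chosen point, so the bound there
  drops by one, and the removed points account for at least \<open>\<delta>\<^sup>2\<close> further pairs. The
  Cauchy-Schwarz inequality combines the two estimates. Loops count as pairs because \<open>E\<close> is
  reflexive.
\<close>

lemma turan_inequality:
  fixes E :: "'i \<Rightarrow> 'i \<Rightarrow> bool"
  assumes "finite I" "reflp E" "symp E" "\<And>U. U \<subseteq> I \<Longrightarrow> independent_in E U \<Longrightarrow> card U \<le> k"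
  shows "card I ^ 2 \<le> k * card {p \<in> I \<times> I. E (fst p) (snd p)}"
  using assms(1,4)
proof (induction k arbitrary: I)
  case 0
  have "I = {}"
  proof (rule ccontr)
    assume "I \<noteq> {}"
    then obtain i where "i \<in> I" by blast
    then show False using 0(2)[of "{i}"] by (simp add: independent_in_def)
  qed
  then show ?case by simp
next
  case (Suc k)
  show ?case
  proof (cases "I = {}")
    case False
    define N where "N i = {j \<in> I. E i j}" for i
    define i where "i = arg_min_on (\<lambda>i. card (N i)) I"
    have i: "i \<in> I" "\<And>j. j \<in> I \<Longrightarrow> card (N i) \<le> card (N j)"
      using arg_min_if_finite(1)[of I "\<lambda>i. card (N i)"] arg_min_least[of I _ "\<lambda>i. card (N i)"]
        Suc.prems(1) False by (auto simp: i_def)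
    define R where "R = I - N i"
    let ?F = "\<lambda>J. {p \<in> J \<times> J. E (fst p) (snd p)}"
    have fin: "finite (N j)" for j using Suc.prems(1) by (simp add: N_def)
    have finF: "finite (?F J)" if "J \<subseteq> I" for J
      by (rule finite_subset[of _ "I \<times> I"]) (use that Suc.prems(1) in auto)
    have "card U \<le> k" if U: "U \<subseteq> R" "independent_in E U" for U
    proof -
      have "i \<notin> U" using U(1) i(1) assms(2) by (auto simp: R_def N_def reflp_def)
      moreover have "independent_in E (insert i U)"
        using U assms(3) unfolding independent_in_def pairwise_insert
        by (auto simp: R_def N_def dest: sympD)
      moreover have "finite U" using U(1) Suc.prems(1) finite_subset by (auto simp: R_def)
      ultimately show ?thesis
        using Suc.prems(2)[of "insert i U"] U(1) i(1) by (auto simp: R_def)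
    qed
    then have IH: "card R ^ 2 \<le> k * card (?F R)"
      using Suc.prems(1) by (intro Suc.IH) (auto simp: R_def)
    have "card (N i) ^ 2 \<le> (\<Sum>j\<in>N i. card (N j))"
      using sum_mono[of "N i" "\<lambda>_. card (N i)" "\<lambda>j. card (N j)"] i(2)
      by (auto simp: N_def power2_eq_square)
    also have "\<dots> = card (Sigma (N i) N)" using fin by simp
    finally have "card (?F R) + card (N i) ^ 2 \<le> card (?F R) + card (Sigma (N i) N)" by simp
    also have "\<dots> = card (?F R \<union> Sigma (N i) N)"
      using finF[of R] fin by (intro card_Un_disjoint[symmetric]) (auto simp: R_def)
    also have "\<dots> \<le> card (?F I)"
      using finF[of I] by (intro card_mono) (auto simp: R_def N_def)
    finally have X: "card (?F R) + card (N i) ^ 2 \<le> card (?F I)" .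
    have "card I = card R + card (N i)"
      using Suc.prems(1) fin[of i] unfolding R_def
      by (metis (no_types, lifting) N_def card_Diff_subset card_mono le_add_diff_inverse2 mem_Collect_eq subsetI)
    moreover have "(card R + card (N i)) ^ 2 \<le> Suc k * (card (?F R) + card (N i) ^ 2)"
    proof (cases "k = 0")
      case True
      then show ?thesis using IH by simp
    next
      case False
      define e d x where "e = int (card R)" and "d = int (card (N i))" and "x = int (card (?F R))"
      have "e ^ 2 \<le> int k * x"
        using IH unfolding e_def x_def by (simp only: flip: of_nat_mult of_nat_power of_nat_le_iff)
      moreover have "0 \<le> (e - int k * d) ^ 2" by simp
      ultimately have "int k * (2 * e * d) \<le> int k * (x + int k * d ^ 2)"
        by (simp add: power2_eq_square algebra_simps)
      then have "2 * e * d \<le> x + int k * d ^ 2" using False by simp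
      then have "(e + d) ^ 2 \<le> int (Suc k) * (x + d ^ 2)"
        using \<open>e ^ 2 \<le> int k * x\<close> by (simp add: power2_eq_square algebra_simps)
      then show ?thesis
        unfolding e_def x_def d_def by (simp only: flip: of_nat_mult of_nat_power of_nat_add of_nat_le_iff)
    qed
    ultimately show ?thesis using X by (metis (no_types, lifting) le_trans mult_le_mono2)
  qed simp
qed

text \<open>
  The product \<open>linear_sum V ^ d\<close>, with \<open>d = card I\<close>, is the sum over all words \<open>w\<close> in \<open>V\<close> with
  positions in \<open>I\<close>. If two factors are replaced by the edge form, then only those words
  survive whose letters at two positions are adjacent, and any two positions can be used. Averaging
  over the positions later gives access to the coefficients without multinomial numbers.
\<close>

lemma sum_words_adjacent:
  fixes E :: "'a \<Rightarrow> 'a \<Rightarrow> bool"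
  assumes "finite V" "finite I" "i \<in> I" "j \<in> I" "i \<noteq> j"
  shows "(\<Sum>w\<in>I \<rightarrow>\<^sub>E V. const (of_bool (E (w i) (w j))) * (\<Prod>l\<in>I. var (w l))) =
    linear_sum V ^ (card I - 2) * edge_form V E"
proof -
  let ?x = "\<lambda>w. \<Prod>l\<in>I. var (w l) :: 'a mpoly"
  have pq: "(\<Sum>w\<in>I \<rightarrow>\<^sub>E V. if w i = p \<and> w j = q then ?x w else 0) =
      linear_sum V ^ (card I - 2) * (var p * var q)" if "p \<in> V" "q \<in> V" for p q
  proof -
    define h where "h l a = (if l = i \<and> a \<noteq> p \<or> l = j \<and> a \<noteq> q then 0 else var a :: 'a mpoly)" for l a
    have "(if w i = p \<and> w j = q then ?x w else 0) = (\<Prod>l\<in>I. h l (w l))" for w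
    proof (cases "w i = p \<and> w j = q")
      case True
      then show ?thesis by (auto simp: h_def intro!: prod.cong)
    next
      case False
      then have "\<exists>l\<in>I. h l (w l) = 0" using assms by (auto simp: h_def)
      then have "(\<Prod>l\<in>I. h l (w l)) = 0" using assms(2) by (intro prod_zero)
      then show ?thesis using False by auto
    qed
    then have "(\<Sum>w\<in>I \<rightarrow>\<^sub>E V. if w i = p \<and> w j = q then ?x w else 0) = (\<Prod>l\<in>I. \<Sum>a\<in>V. h l a)"
      using assms(1,2) by (simp add: prod_sum_PiE)
    also have "\<dots> = (\<Sum>a\<in>V. h i a) * ((\<Sum>a\<in>V. h j a) * (\<Prod>l\<in>I - {i} - {j}. \<Sum>a\<in>V. h l a))"
      using assms by (simp add: prod.remove[of I i] prod.remove[of "I - {i}" j])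
    also have "(\<Sum>a\<in>V. h i a) = (\<Sum>a\<in>V. if a = p then var p else 0)"
      using assms(5) by (intro sum.cong) (auto simp: h_def)
    also have "\<dots> = var p" using that assms(1) by simp
    also have "(\<Sum>a\<in>V. h j a) = (\<Sum>a\<in>V. if a = q then var q else 0)"
      using assms(5) by (intro sum.cong) (auto simp: h_def)
    also have "\<dots> = var q" using that assms(1) by simp
    also have "(\<Prod>l\<in>I - {i} - {j}. \<Sum>a\<in>V. h l a) = (\<Prod>l\<in>I - {i} - {j}. linear_sum V)"
      by (intro prod.cong) (auto simp: h_def linear_sum_def)
    also have "\<dots> = linear_sum V ^ (card I - 2)"
      using assms by (simp add: numeral_2_eq_2)
    finally show ?thesis by (simp add: mult_ac)
  qed
  have "(\<Sum>w\<in>I \<rightarrow>\<^sub>E V. const (of_bool (E (w i) (w j))) * ?x w) =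
      (\<Sum>w\<in>I \<rightarrow>\<^sub>E V. \<Sum>p\<in>V. \<Sum>q\<in>V. const (of_bool (E p q)) * (if w i = p \<and> w j = q then ?x w else 0))"
  proof (intro sum.cong refl)
    fix w assume w: "w \<in> I \<rightarrow>\<^sub>E V"
    have "(\<Sum>p\<in>V. \<Sum>q\<in>V. const (of_bool (E p q)) * (if w i = p \<and> w j = q then ?x w else 0)) =
        (\<Sum>p\<in>V. if p = w i then (\<Sum>q\<in>V. if q = w j then const (of_bool (E p q)) * ?x w else 0) else 0)"
      by (intro sum.cong refl) (auto intro!: sum.cong)
    also have "\<dots> = const (of_bool (E (w i) (w j))) * ?x w"
      using w assms by (auto simp: PiE_def Pi_def)
    finally show "const (of_bool (E (w i) (w j))) * ?x w =
      (\<Sum>p\<in>V. \<Sum>q\<in>V. const (of_bool (E p q)) * (if w i = p \<and> w j = q then ?x w else 0))" by simp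
  qed
  also have "\<dots> = (\<Sum>p\<in>V. \<Sum>q\<in>V. const (of_bool (E p q)) *
      (\<Sum>w\<in>I \<rightarrow>\<^sub>E V. if w i = p \<and> w j = q then ?x w else 0))"
    unfolding sum_distrib_left
    by (subst sum.swap, intro sum.cong refl, subst sum.swap) simp
  also have "\<dots> = (\<Sum>p\<in>V. \<Sum>q\<in>V. const (of_bool (E p q)) * (linear_sum V ^ (card I - 2) * (var p * var q)))"
    using pq by (intro sum.cong refl) simp
  also have "\<dots> = linear_sum V ^ (card I - 2) * edge_form V E"
    by (simp add: edge_form_def sum_distrib_left mult_ac)
  finally show ?thesis .
qed

text \<open>
  Expand into words \<open>w\<close> of length \<open>d = r + 2\<close> and average over all pairs of distinct positions. The
  coefficient of \<open>w\<close> is nonnegative if \<open>(k + 1) c \<ge> d (d - 1)\<close>, where \<open>c\<close> counts the ordered pairs of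
  distinct positions with adjacent or equal letters. Equal letters are adjacent, so
  independent sets of positions yield independent sets of vertices, and Turan's inequality gives
  \<open>k (c + d) \<ge> d\<^sup>2\<close>. The claim follows if \<open>d \<ge> k\<^sup>2\<close>.
\<close>

lemma polya_motzkin_straus:
  fixes E :: "'a \<Rightarrow> 'a \<Rightarrow> bool"
  assumes V: "finite V" and E: "reflp E" "symp E"
    and indep: "\<And>U. U \<subseteq> V \<Longrightarrow> independent_in E U \<Longrightarrow> card U \<le> k"
    and r: "k ^ 2 \<le> r + 2"
  shows "linear_sum V ^ r * (const (real (k + 1)) * edge_form V E - linear_sum V ^ 2) \<in> N_cone V (r + 2)"
proof -
  define I where "I = {..<r + 2}"
  define d where "d = r + 2"
  define W where "W = I \<rightarrow>\<^sub>E V"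
  define x where "x w = (\<Prod>l\<in>I. var (w l) :: 'a mpoly)" for w
  define P where "P = {p \<in> I \<times> I. fst p \<noteq> snd p}"
  define D where "D = {p \<in> I \<times> I. fst p = snd p}"
  define adj where "adj w p \<longleftrightarrow> E (w (fst p)) (w (snd p))" for w and p :: "nat \<times> nat"
  define c where "c w = card {p \<in> P. adj w p}" for w
  have I: "finite I" "card I = d" by (simp_all add: I_def d_def)
  have fin: "finite P" "finite D" using I by (simp_all add: P_def D_def)
  have "D = (\<lambda>i. (i, i)) ` I" by (auto simp: D_def)
  then have cardD: "card D = d"
    using I by (simp add: card_image inj_on_def)
  have "card (I \<times> I) = card (P \<union> D)"
    by (rule arg_cong[of _ _ card]) (auto simp: P_def D_def)
  also have "\<dots> = card P + card D"
    by (rule card_Un_disjoint) (use fin in \<open>auto simp: P_def D_def\<close>)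
  finally have "d * d = card P + d"
    using I cardD by simp
  then have cardP: "real (card P) = real d * real d - real d"
    by (simp flip: of_nat_mult)
  have total: "linear_sum V ^ d = (\<Sum>w\<in>W. x w)"
  proof -
    have "linear_sum V ^ d = (\<Prod>l\<in>I. \<Sum>a\<in>V. var a)"
      using I by (simp add: linear_sum_def)
    also have "\<dots> = (\<Sum>w\<in>W. x w)"
      using prod_sum_PiE[of I "\<lambda>_. V" "\<lambda>_. var"] I V unfolding W_def x_def by simp
    finally show ?thesis .
  qed
  have edges: "const (real (card P)) * (linear_sum V ^ r * edge_form V E) = (\<Sum>w\<in>W. const (real (c w)) * x w)"
  proof -
    have "const (real (card P)) * (linear_sum V ^ r * edge_form V E) = (\<Sum>p\<in>P. linear_sum V ^ r * edge_form V E)"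
      by (simp add: const_of_nat)
    also have "\<dots> = (\<Sum>p\<in>P. \<Sum>w\<in>W. const (of_bool (adj w p)) * x w)"
    proof (intro sum.cong refl)
      fix p assume "p \<in> P"
      then show "linear_sum V ^ r * edge_form V E = (\<Sum>w\<in>W. const (of_bool (adj w p)) * x w)"
        using sum_words_adjacent[OF V I(1), of "fst p" "snd p" E] I(2)
        by (auto simp: P_def d_def W_def x_def adj_def)
    qed
    also have "\<dots> = (\<Sum>w\<in>W. \<Sum>p\<in>P. const (of_bool (adj w p)) * x w)"
      by (rule sum.swap)
    also have "\<dots> = (\<Sum>w\<in>W. const (real (c w)) * x w)"
    proof (intro sum.cong refl)
      fix w
      have "real (c w) = (\<Sum>p\<in>P. of_bool (adj w p))"
        using fin(1) by (simp add: c_def Collect_conj_eq)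
      then show "(\<Sum>p\<in>P. const (of_bool (adj w p)) * x w) = const (real (c w)) * x w"
        by (simp only: const_sum sum_distrib_right)
    qed
    finally show ?thesis .
  qed
  have nonneg: "real (k + 1) * real (c w) - real (card P) \<ge> 0" if w: "w \<in> W" for w
  proof -
    let ?F = "{p \<in> I \<times> I. E (w (fst p)) (w (snd p))}"
    have "card U \<le> k" if U: "U \<subseteq> I" "independent_in (\<lambda>i j. E (w i) (w j)) U" for U
    proof -
      have inj: "inj_on w U"
      proof (rule inj_onI, rule ccontr)
        fix i j assume "i \<in> U" "j \<in> U" "w i = w j" "i \<noteq> j"
        then show False
          using U(2) reflpD[OF E(1), of "w j"] by (auto simp: independent_in_def pairwise_def)
      qed
      have "independent_in E (w ` U)"
        using U(2) by (auto simp: independent_in_def pairwise_def)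
      moreover have "w ` U \<subseteq> V" using w U(1) by (auto simp: W_def PiE_def Pi_def)
      ultimately show ?thesis using indep[of "w ` U"] card_image[OF inj] by simp
    qed
    then have "card I ^ 2 \<le> k * card ?F"
      using E by (intro turan_inequality I) (auto simp: reflp_def symp_def)
    then have "real (d ^ 2) \<le> real (k * card ?F)"
      using I(2) by (simp only: of_nat_le_iff)
    moreover have "card ?F = c w + d"
    proof -
      have "?F = {p \<in> P. adj w p} \<union> D"
        using reflpD[OF E(1)] by (auto simp: P_def D_def adj_def)
      also have "card \<dots> = card {p \<in> P. adj w p} + card D"
        by (rule card_Un_disjoint, use fin in simp, use fin in simp) (auto simp: P_def D_def)
      finally show ?thesis by (simp add: c_def cardD)
    qed
    ultimately have turan: "real d * real d \<le> real k * (real (c w) + real d)"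
      by (simp add: power2_eq_square)
    have "real (k ^ 2) \<le> real d"
      using r unfolding d_def of_nat_le_iff .
    then have "real k * real k * real d \<le> real d * real d"
      by (intro mult_right_mono) (simp_all add: power2_eq_square)
    moreover have "real (k + 1) * (real d * real d) \<le> real (k + 1) * (real k * (real (c w) + real d))"
      using turan by (rule mult_left_mono) simp
    ultimately have *: "real k * real (card P) \<le> real k * (real (k + 1) * real (c w))"
      unfolding cardP by (simp add: algebra_simps)
    show ?thesis
    proof (cases "k = 0")
      case True
      then have "real d * real d \<le> 0" using turan by simp
      moreover have "real d * real d > 0" unfolding d_def by (intro mult_pos_pos) simp_all
      ultimately show ?thesis by linarith
    next
      case False
      then show ?thesis using * by simp
    qed
  qed
  have "const (real (card P)) * (linear_sum V ^ r * (const (real (k + 1)) * edge_form V E - linear_sum V ^ 2))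
      = const (real (k + 1)) * (const (real (card P)) * (linear_sum V ^ r * edge_form V E))
        - const (real (card P)) * linear_sum V ^ d"
    unfolding d_def power_add right_diff_distrib by (simp only: mult_ac)
  also have "\<dots> = (\<Sum>w\<in>W. const (real (k + 1) * real (c w) - real (card P)) * x w)"
    unfolding edges total
    by (simp only: sum_distrib_left const_diff const_mult left_diff_distrib sum_subtractf mult.assoc)
  also have "\<dots> \<in> N_cone V d"
  proof (intro N_cone_sum N_cone_const_mult nonneg)
    fix w assume "w \<in> W"
    then have "x w \<in> N_cone V (\<Sum>l\<in>I. 1)"
      unfolding x_def by (intro N_cone_prod N_cone_var) (auto simp: W_def PiE_def Pi_def)
    then show "x w \<in> N_cone V d" using I by simp
  qed
  finally have "const (real (card P)) * (linear_sum V ^ r * (const (real (k + 1)) * edge_form V E - linear_sum V ^ 2))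
    \<in> N_cone V d" .
  moreover have "real (card P) > 0"
    unfolding cardP d_def by (simp add: algebra_simps add_pos_nonneg)
  ultimately show ?thesis
    unfolding d_def by (rule N_cone_const_cancel[rotated])
qed

text \<open>
  The closed neighbourhood of \<open>v\<close> becomes a clique and a connected component; the graph on the other
  vertices stays as it is.
\<close>

definition isolate :: "('a \<Rightarrow> 'a \<Rightarrow> bool) \<Rightarrow> 'a \<Rightarrow> 'a \<Rightarrow> 'a \<Rightarrow> bool" where
  "isolate E v a b \<longleftrightarrow> E v a \<and> E v b \<or> \<not> E v a \<and> \<not> E v b \<and> E a b"

text \<open>
  The difference is the cubic form whose coefficient \<open>g v a b\<close> at \<open>x\<^sub>v x\<^sub>a x\<^sub>b\<close> tells whether the
  pair \<open>a, b\<close> is lost or gained when \<open>v\<close> is isolated. These numbers can be negative, but the sum over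
  the three rotations of a triple cannot: two adjacent vertices with a third vertex joined to neither
  change nothing, on a path two pairs are lost and one is gained, and the other triples do not
  change. Triples with vertices outside the union \<open>R\<close> of components contribute nothing.
\<close>

lemma isolate_step:
  fixes E :: "'a \<Rightarrow> 'a \<Rightarrow> bool"
  assumes V: "finite V" and R: "R \<subseteq> V" and E: "reflp E" "symp E"
    and closed: "\<And>v a. v \<in> R \<Longrightarrow> a \<in> V \<Longrightarrow> E v a \<Longrightarrow> a \<in> R"
  shows "linear_sum R * edge_form V E - (\<Sum>v\<in>R. var v * edge_form V (isolate E v)) \<in> N_cone V 3"
proof -
  define g where "g v a b = (of_bool (E a b) - of_bool (isolate E v a b) :: real)" for v a b
  let ?m = "\<lambda>v a b. var v * (var a * var b) :: 'a mpoly"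
  let ?S = "\<Sum>v\<in>R. \<Sum>a\<in>R. \<Sum>b\<in>R. const (g v a b) * ?m v a b"
  have zero: "g v a b = 0" if "v \<in> R" "a \<in> V" "b \<in> V" "a \<notin> R \<or> b \<notin> R" for v a b
    using that closed E(2) unfolding g_def isolate_def by (smt (verit) of_bool_eq diff_self sympD)
  have "linear_sum R * edge_form V E - (\<Sum>v\<in>R. var v * edge_form V (isolate E v)) =
      (\<Sum>v\<in>R. \<Sum>a\<in>V. \<Sum>b\<in>V. const (g v a b) * ?m v a b)"
  proof -
    have "var v * edge_form V E - var v * edge_form V (isolate E v) =
        (\<Sum>a\<in>V. \<Sum>b\<in>V. const (g v a b) * ?m v a b)" for v
      by (simp add: edge_form_def sum_distrib_left g_def const_diff algebra_simps sum_subtractf)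
    then show ?thesis
      by (simp add: linear_sum_def sum_distrib_right flip: sum_subtractf)
  qed
  also have "\<dots> = ?S"
  proof (rule sum.cong[OF refl])
    fix v assume v: "v \<in> R"
    have "(\<Sum>a\<in>V. \<Sum>b\<in>V. const (g v a b) * ?m v a b) = (\<Sum>a\<in>R. \<Sum>b\<in>V. const (g v a b) * ?m v a b)"
      by (rule sum.mono_neutral_right) (use V R v zero in auto)
    also have "\<dots> = (\<Sum>a\<in>R. \<Sum>b\<in>R. const (g v a b) * ?m v a b)"
      by (rule sum.cong[OF refl], rule sum.mono_neutral_right) (use V R v zero in auto)
    finally show "(\<Sum>a\<in>V. \<Sum>b\<in>V. const (g v a b) * ?m v a b) = (\<Sum>a\<in>R. \<Sum>b\<in>R. const (g v a b) * ?m v a b)" .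
  qed
  finally have S: "linear_sum R * edge_form V E - (\<Sum>v\<in>R. var v * edge_form V (isolate E v)) = ?S" .
  have rotate: "(\<Sum>v\<in>R. \<Sum>a\<in>R. \<Sum>b\<in>R. f v a b) = (\<Sum>v\<in>R. \<Sum>a\<in>R. \<Sum>b\<in>R. f a b v)"
    for f :: "'a \<Rightarrow> 'a \<Rightarrow> 'a \<Rightarrow> 'a mpoly"
    by (subst sum.swap, subst (2) sum.swap, rule refl)
  have "const 3 = (3 :: 'a mpoly)"
    using const_of_nat[of 3] by simp
  then have "const 3 * ?S = ?S + ?S + ?S"
    by simp
  also have "\<dots> = ?S + (\<Sum>v\<in>R. \<Sum>a\<in>R. \<Sum>b\<in>R. const (g a b v) * ?m a b v)
      + (\<Sum>v\<in>R. \<Sum>a\<in>R. \<Sum>b\<in>R. const (g b v a) * ?m b v a)"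
    using rotate[of "\<lambda>v a b. const (g v a b) * ?m v a b"] rotate[of "\<lambda>v a b. const (g a b v) * ?m a b v"]
    by simp
  also have "\<dots> = (\<Sum>v\<in>R. \<Sum>a\<in>R. \<Sum>b\<in>R. const (g v a b + g a b v + g b v a) * ?m v a b)"
    by (simp add: sum.distrib[symmetric] const_add algebra_simps)
  also have "\<dots> \<in> N_cone V 3"
  proof (intro N_cone_sum N_cone_const_mult)
    fix v a b assume *: "v \<in> R" "a \<in> R" "b \<in> R"
    show "g v a b + g a b v + g b v a \<ge> 0"
      using E unfolding g_def isolate_def by (smt (verit) of_bool_eq reflpD sympD)
    have "?m v a b \<in> N_cone V (1 + (1 + 1))"
      using * R by (intro N_cone_mult N_cone_var) auto
    then show "?m v a b \<in> N_cone V 3" by (simp add: numeral_3_eq_3)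
  qed
  finally have "?S \<in> N_cone V 3"
    by (rule N_cone_const_cancel[rotated]) simp
  then show ?thesis by (simp only: S)
qed

section \<open>Greedy elimination\<close>

text \<open>
  If \<open>L\<^sub>t\<close> is the sum over the clique with label \<open>t\<close>, then the form is \<open>card T\<close> times the sum of the
  squares of the \<open>L\<^sub>t\<close>, minus the square of their sum. By Lagrange's identity this is half the sum of
  \<open>(L\<^sub>s - L\<^sub>t)\<^sup>2\<close> over all \<open>s\<close> and \<open>t\<close>.
\<close>

lemma clique_partition_certified:
  fixes c :: "'a \<Rightarrow> 'b"
  assumes V: "finite V" and T: "finite T" and c: "\<And>a. a \<in> V \<Longrightarrow> c a \<in> T"
  shows "certified V 0 (const (real (card T)) * edge_form V (\<lambda>a b. c a = c b) - linear_sum V ^ 2)"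
proof -
  define L where "L t = linear_sum {a \<in> V. c a = t}" for t
  have L: "L t = (\<Sum>a\<in>V. const (of_bool (c a = t)) * var a)" for t
    unfolding L_def linear_sum_def using V by (intro sum.mono_neutral_cong_left) auto
  have total: "linear_sum V = (\<Sum>t\<in>T. L t)"
    unfolding L_def linear_sum_def using V T c by (intro sum.group[symmetric]) auto
  have "(\<Sum>t\<in>T. L t ^ 2) = (\<Sum>t\<in>T. \<Sum>a\<in>V. \<Sum>b\<in>V. const (of_bool (c a = t \<and> c b = t)) * (var a * var b))"
    unfolding L power2_eq_square sum_product
    by (intro sum.cong refl) (simp add: mult_ac flip: const_mult of_bool_conj)
  also have "\<dots> = (\<Sum>a\<in>V. \<Sum>b\<in>V. \<Sum>t\<in>T. const (of_bool (c a = t \<and> c b = t)) * (var a * var b))"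
    by (subst sum.swap, intro sum.cong refl, rule sum.swap)
  also have "\<dots> = edge_form V (\<lambda>a b. c a = c b)"
    unfolding edge_form_def
  proof (intro sum.cong refl)
    fix a b assume "a \<in> V" "b \<in> V"
    then have "(\<Sum>t\<in>T. of_bool (c a = t \<and> c b = t)) = (of_bool (c a = c b) :: real)"
      using T c by (cases "c a = c b") (auto simp: of_bool_def intro!: sum.neutral)
    then show "(\<Sum>t\<in>T. const (of_bool (c a = t \<and> c b = t)) * (var a * var b)) =
        const (of_bool (c a = c b)) * (var a * var b)"
      by (simp only: flip: sum_distrib_right const_sum)
  qed
  finally have edges: "edge_form V (\<lambda>a b. c a = c b) = (\<Sum>t\<in>T. L t ^ 2)" ..
  have half: "const (1 / 2) * 2 = (1 :: 'a mpoly)"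
  proof -
    have "const (1 / 2) * const (real 2) = (1 :: 'a mpoly)" by (simp flip: const_mult)
    then show ?thesis unfolding const_of_nat by simp
  qed
  have "(\<Sum>s\<in>T. \<Sum>t\<in>T. const (1 / 2) * (L s - L t) ^ 2) =
      const (1 / 2) * (\<Sum>s\<in>T. \<Sum>t\<in>T. L s ^ 2 + L t ^ 2 - 2 * (L s * L t))"
    by (simp add: sum_distrib_left power2_eq_square algebra_simps)
  also have "(\<Sum>s\<in>T. \<Sum>t\<in>T. L s ^ 2 + L t ^ 2 - 2 * (L s * L t)) =
      2 * (of_nat (card T) * (\<Sum>t\<in>T. L t ^ 2) - (\<Sum>t\<in>T. L t) ^ 2)"
    by (simp add: sum.distrib sum_subtractf power2_eq_square sum_product sum_distrib_left algebra_simps)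
  also have "const (1 / 2) * \<dots> = of_nat (card T) * (\<Sum>t\<in>T. L t ^ 2) - (\<Sum>t\<in>T. L t) ^ 2"
    unfolding mult.assoc[symmetric] half by simp
  also have "\<dots> = const (real (card T)) * edge_form V (\<lambda>a b. c a = c b) - linear_sum V ^ 2"
    unfolding edges total const_of_nat ..
  finally have "const (real (card T)) * edge_form V (\<lambda>a b. c a = c b) - linear_sum V ^ 2 =
      (\<Sum>s\<in>T. \<Sum>t\<in>T. const (1 / 2) * (L s - L t) ^ 2)" ..
  moreover have "L t \<in> forms V 1" for t
    unfolding L_def by (rule linear_sum_forms) auto
  ultimately show ?thesis
    by (auto intro!: certified_sum certified_square N_cone_const forms_diff)
qed

text \<open>
  Graphs are given by the relation ``adjacent or equal'', so that the closed neighbourhood of \<open>t\<close> is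
  \<open>{a. E t a}\<close>.
\<close>

locale reflexive_graph =
  fixes V :: "'a set" and E :: "'a \<Rightarrow> 'a \<Rightarrow> bool" and \<alpha> :: nat
  assumes finite_V: "finite V" and refl_E: "reflp E" and sym_E: "symp E"
    and card_stable_le: "\<And>U. U \<subseteq> V \<Longrightarrow> independent_in E U \<Longrightarrow> card U \<le> \<alpha>"
begin

definition stable :: "'a set \<Rightarrow> bool" where
  "stable U \<longleftrightarrow> U \<subseteq> V \<and> independent_in E U"

definition extendable :: "'a set \<Rightarrow> bool" where
  "extendable U \<longleftrightarrow> (\<exists>S. stable S \<and> card S = \<alpha> \<and> U \<subseteq> S)"

definition residual :: "'a set \<Rightarrow> 'a set" where
  "residual T = {a \<in> V. \<forall>t\<in>T. \<not> E t a}"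

text \<open>
  The graph after the greedy algorithm has chosen \<open>T\<close>: the residual vertices keep their edges, and
  the deleted vertices form cliques, labelled by \<open>c\<close> with the chosen vertex that deleted
  them. The labels are needed since \<open>T\<close> does not determine the order of the choices. The last
  clause also makes the relation reflexive and symmetric outside \<open>V\<close>.
\<close>

definition greedy_graph :: "'a set \<Rightarrow> ('a \<Rightarrow> 'a) \<Rightarrow> 'a \<Rightarrow> 'a \<Rightarrow> bool" where
  "greedy_graph T c a b \<longleftrightarrow> (if a \<in> residual T \<and> b \<in> residual T then E a b
     else a \<notin> residual T \<and> b \<notin> residual T \<and> c a = c b)"

lemma residual_subset: "residual T \<subseteq> V"
  by (auto simp: residual_def)

lemma residual_insert: "residual (insert v T) = {a \<in> residual T. \<not> E v a}"
  by (auto simp: residual_def)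

lemma reflp_greedy_graph: "reflp (greedy_graph T c)" and symp_greedy_graph: "symp (greedy_graph T c)"
  using reflpD[OF refl_E] sympD[OF sym_E] by (auto simp: greedy_graph_def intro!: reflpI sympI split: if_splits)

lemma finite_stable: "stable U \<Longrightarrow> finite U"
  using finite_V finite_subset by (auto simp: stable_def)

lemma stable_card_le: "stable U \<Longrightarrow> card U \<le> \<alpha>"
  using card_stable_le by (auto simp: stable_def)

lemma stable_Un_residual:
  assumes "stable T" "stable U" "U \<subseteq> residual T"
  shows "stable (T \<union> U)"
proof -
  have "\<not> E u v" if "u \<in> T \<union> U" "v \<in> T \<union> U" "u \<noteq> v" for u v
    using that assms sympD[OF sym_E, of u v]
    by (auto simp: stable_def independent_in_def pairwise_def residual_def)
  then show ?thesis
    using assms by (simp add: stable_def independent_in_def pairwise_def)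
qed

lemma disjoint_residual: "T \<inter> residual T = {}"
  using refl_E by (auto simp: residual_def reflp_def)

lemma stable_insert:
  assumes "stable T" "v \<in> residual T"
  shows "stable (insert v T)" "v \<notin> T"
proof -
  have "stable {v}"
    using assms(2) residual_subset by (auto simp: stable_def independent_in_def)
  then show "stable (insert v T)"
    using stable_Un_residual[OF assms(1), of "{v}"] assms(2) by simp
  show "v \<notin> T" using assms(2) disjoint_residual by blast
qed

lemma residual_maximum_stable:
  assumes "stable T" "card T = \<alpha>"
  shows "residual T = {}"
proof (rule ccontr)
  assume "residual T \<noteq> {}"
  then obtain v where "v \<in> residual T" by blast
  then show False
    using stable_insert[OF assms(1), of v] stable_card_le[of "insert v T"]
      finite_stable[OF assms(1)] assms(2) by simp
qed

lemma residual_nonempty: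
  assumes "extendable U" "card U < \<alpha>"
  shows "residual U \<noteq> {}"
proof -
  obtain S where S: "stable S" "card S = \<alpha>" "U \<subseteq> S"
    using assms(1) by (auto simp: extendable_def)
  have "U \<noteq> S" using S(2) assms(2) by auto
  then obtain v where v: "v \<in> S" "v \<notin> U" using S(3) by blast
  have "\<not> E u v" if "u \<in> U" for u
    using S(1,3) v that by (auto simp: stable_def independent_in_def pairwise_def)
  then have "v \<in> residual U"
    using S(1) v(1) by (auto simp: stable_def residual_def)
  then show ?thesis by blast
qed

text \<open>
  An independent set has at most one vertex in each clique, thus at most \<open>card T\<close> deleted vertices.
  Its residual vertices together with \<open>T\<close> are stable in the original graph, and not maximum, since
  \<open>T\<close> does not extend to a maximum stable set.
\<close>

lemma greedy_graph_independent_card: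
  assumes T: "stable T" "\<not> extendable T" and c: "\<And>a. a \<in> V \<Longrightarrow> a \<notin> residual T \<Longrightarrow> c a \<in> T"
    and U: "U \<subseteq> V" "independent_in (greedy_graph T c) U"
  shows "card U < \<alpha>"
proof -
  let ?A = "U - residual T" and ?B = "U \<inter> residual T"
  have fin: "finite U" using U(1) finite_V finite_subset by blast
  have "inj_on c ?A"
  proof (rule inj_onI, rule ccontr)
    fix a b assume ab: "a \<in> ?A" "b \<in> ?A" "c a = c b" "a \<noteq> b"
    then have "\<not> greedy_graph T c a b" using U(2) by (auto simp: independent_in_def pairwise_def)
    with ab show False by (simp add: greedy_graph_def)
  qed
  moreover have "c ` ?A \<subseteq> T" using c U(1) by auto
  ultimately have le: "card ?A \<le> card T"
    using finite_stable[OF T(1)] by (rule card_inj_on_le)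
  have "\<not> E a b" if "a \<in> ?B" "b \<in> ?B" "a \<noteq> b" for a b
  proof -
    have "\<not> greedy_graph T c a b" using U(2) that by (auto simp: independent_in_def pairwise_def)
    then show ?thesis using that by (simp add: greedy_graph_def)
  qed
  then have "stable ?B"
    using U(1) by (auto simp: stable_def independent_in_def pairwise_def)
  then have TB: "stable (T \<union> ?B)"
    by (intro stable_Un_residual T) auto
  then have "card (T \<union> ?B) \<noteq> \<alpha>"
    using T(2) by (auto simp: extendable_def)
  then have lt: "card (T \<union> ?B) < \<alpha>"
    using stable_card_le[OF TB] by simp
  have "card (T \<union> ?B) = card T + card ?B"
    using finite_stable[OF T(1)] fin disjoint_residual[of T] by (intro card_Un_disjoint) auto
  moreover have "card U = card ?B + card ?A"
    using fin card_Int_Diff by blast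
  ultimately show ?thesis using le lt by simp
qed

lemma isolate_greedy_graph:
  assumes T: "stable T" and v: "v \<in> residual T" and ab: "a \<in> V" "b \<in> V"
    and c: "\<And>a. a \<in> V \<Longrightarrow> a \<notin> residual T \<Longrightarrow> c a \<in> T"
  shows "isolate (greedy_graph T c) v a b \<longleftrightarrow> greedy_graph (insert v T) (\<lambda>a. if a \<in> residual T then v else c a) a b"
proof -
  have ne: "c a \<noteq> v" if "a \<in> V" "a \<notin> residual T" for a
    using stable_insert(2)[OF T v] c[OF that] by auto
  show ?thesis
    unfolding isolate_def greedy_graph_def residual_insert
    by (cases "a \<in> residual T"; cases "b \<in> residual T")
      (use v ne[of a] ne[of b] ab in \<open>simp_all\<close>)
qed

text \<open>
  The set \<open>\<U>\<close> may contain more than the sets that are needed from \<open>T\<close> onwards. This lets the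
  induction remove the factor of \<open>T\<close> from the product in each step and keep the same remaining factor
  in all branches, although each branch \<open>insert v T\<close> uses only part of it.
\<close>

lemma greedy_certificate:
  assumes "stable T" "\<And>a. a \<in> V \<Longrightarrow> a \<notin> residual T \<Longrightarrow> c a \<in> T"
    and "finite \<U>" "{U. extendable U \<and> card U < \<alpha> \<and> T \<subseteq> U} \<subseteq> \<U>"
  shows "certified V (\<alpha> ^ 2 + card \<U>) (linear_sum V ^ (\<alpha> ^ 2) * (\<Prod>U\<in>\<U>. linear_sum (residual U)) *
    (const (real \<alpha>) * edge_form V (greedy_graph T c) - linear_sum V ^ 2))"
  using assms
proof (induction "\<alpha> - card T" arbitrary: T c \<U> rule: less_induct)
  case less
  let ?m = "linear_sum V ^ (\<alpha> ^ 2) :: 'a mpoly"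
  let ?f = "const (real \<alpha>) * edge_form V (greedy_graph T c) - linear_sum V ^ 2"
  have m: "?m \<in> N_cone V (\<alpha> ^ 2)"
    using N_cone_power[OF linear_sum_N_cone[of V V], of "\<alpha> ^ 2"] by simp
  have P: "(\<Prod>U\<in>\<W>. linear_sum (residual U)) \<in> N_cone V (card \<W>)" for \<W>
    using N_cone_prod[of \<W> "\<lambda>U. linear_sum (residual U)" V "\<lambda>_. 1"] residual_subset
    by (simp add: linear_sum_N_cone[unfolded One_nat_def])
  consider "\<not> extendable T" | "extendable T" "card T = \<alpha>" | "extendable T" "card T < \<alpha>"
    using stable_card_le[OF less.prems(1)] by linarith
  then show ?case
  proof cases
    case 1
    then have "card T \<noteq> \<alpha>" using less.prems(1) by (auto simp: extendable_def)
    then have "\<alpha> > 0" using stable_card_le[OF less.prems(1)] by simp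
    then have \<alpha>: "real \<alpha> = real ((\<alpha> - 1) + 1)" by simp
    have "?m * ?f \<in> N_cone V (\<alpha> ^ 2 + 2)"
      unfolding \<alpha>
    proof (rule polya_motzkin_straus[OF finite_V reflp_greedy_graph symp_greedy_graph])
      fix U assume U: "U \<subseteq> V" "independent_in (greedy_graph T c) U"
      have "card U < \<alpha>"
        using greedy_graph_independent_card[of T c U] less.prems(1,2) 1 U by simp
      then show "card U \<le> \<alpha> - 1" by simp
    next
      have "(\<alpha> - 1) ^ 2 \<le> \<alpha> ^ 2" by (rule power_mono) simp_all
      then show "(\<alpha> - 1) ^ 2 \<le> \<alpha> ^ 2 + 2" by (rule order_trans) simp
    qed
    then have "certified V (\<alpha> ^ 2) (?m * ?f)" by (rule certified_nonneg)
    from certified_mult[OF P this, of \<U>] show ?thesis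
      by (simp only: mult.assoc mult.left_commute add.commute)
  next
    case 2
    have "residual T = {}"
      using residual_maximum_stable[OF less.prems(1) 2(2)] .
    then have "edge_form V (greedy_graph T c) = edge_form V (\<lambda>a b. c a = c b)"
      by (simp add: greedy_graph_def[abs_def])
    moreover have "certified V 0 (const (real (card T)) * edge_form V (\<lambda>a b. c a = c b) - linear_sum V ^ 2)"
      using less.prems(2) \<open>residual T = {}\<close>
      by (intro clique_partition_certified finite_V finite_stable less.prems(1)) auto
    ultimately have "certified V 0 ?f" using 2(2) by simp
    from certified_mult[OF N_cone_mult[OF m P] this, of \<U>] show ?thesis by simp
  next
    case 3
    let ?R = "residual T"
    define \<W> where "\<W> = \<U> - {T}"
    have "T \<in> \<U>" using less.prems(4) 3 by auto
    then have \<U>: "\<U> = insert T \<W>" "T \<notin> \<W>" "finite \<W>" using less.prems(3) by (auto simp: \<W>_def)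
    \<comment> \<open>All factors but the one of \<open>T\<close>, which is spent on choosing the next vertex.\<close>
    define Q where "Q = ?m * (\<Prod>U\<in>\<W>. linear_sum (residual U))"
    have Q: "Q \<in> N_cone V (\<alpha> ^ 2 + card \<W>)"
      unfolding Q_def using m P by (rule N_cone_mult)
    let ?c = "\<lambda>v a. if a \<in> ?R then v else c a"
    let ?F = "\<lambda>v. edge_form V (greedy_graph (insert v T) (?c v)) :: 'a mpoly"
    define f where "f = ?f"
    define g where "g v = const (real \<alpha>) * ?F v - linear_sum V ^ 2" for v
    define h where "h = linear_sum ?R * edge_form V (greedy_graph T c) - (\<Sum>v\<in>?R. var v * ?F v)"
    have h: "h \<in> N_cone V 3"
    proof -
      have "?F v = edge_form V (isolate (greedy_graph T c) v)" if "v \<in> ?R" for v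
        using isolate_greedy_graph[OF less.prems(1) that _ _ less.prems(2)] by (intro edge_form_cong) simp
      then have "h = linear_sum ?R * edge_form V (greedy_graph T c) - (\<Sum>v\<in>?R. var v * edge_form V (isolate (greedy_graph T c) v))"
        by (simp add: h_def)
      also have "\<dots> \<in> N_cone V 3"
        by (intro isolate_step finite_V residual_subset reflp_greedy_graph symp_greedy_graph) (auto simp: greedy_graph_def split: if_splits)
      finally show ?thesis .
    qed
    have "(\<Sum>v\<in>?R. var v * g v) = const (real \<alpha>) * (\<Sum>v\<in>?R. var v * ?F v) - linear_sum ?R * linear_sum V ^ 2"
      unfolding g_def linear_sum_def[of ?R] sum_distrib_left sum_distrib_right right_diff_distrib sum_subtractf
      by (simp only: mult.left_commute)
    then have "linear_sum ?R * f = (\<Sum>v\<in>?R. var v * g v) + const (real \<alpha>) * h"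
      unfolding f_def h_def right_diff_distrib by (simp add: mult.left_commute)
    then have "Q * (linear_sum ?R * f) = Q * (\<Sum>v\<in>?R. var v * g v) + Q * (const (real \<alpha>) * h)"
      by (simp only: distrib_left)
    also have "Q * (\<Sum>v\<in>?R. var v * g v) = (\<Sum>v\<in>?R. var v * (Q * g v))"
      unfolding sum_distrib_left by (simp only: mult.left_commute)
    finally have split: "Q * (linear_sum ?R * f) = (\<Sum>v\<in>?R. var v * (Q * g v)) + Q * (const (real \<alpha>) * h)" .
    have step: "certified V (\<alpha> ^ 2 + card \<U>) (var v * (Q * g v))" if v: "v \<in> ?R" for v
    proof -
      note st = stable_insert[OF less.prems(1) v]
      have "card (insert v T) = Suc (card T)"
        using st(2) finite_stable[OF less.prems(1)] by simp
      then have "certified V (\<alpha> ^ 2 + card \<W>) (Q * g v)"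
        unfolding Q_def g_def
      proof (intro less.hyps st(1) \<U>(3))
        show "\<alpha> - card (insert v T) < \<alpha> - card T"
          using \<open>card (insert v T) = Suc (card T)\<close> 3(2) by simp
        show "?c v a \<in> insert v T" if "a \<in> V" "a \<notin> residual (insert v T)" for a
          using that less.prems(2) by auto
        show "{U. extendable U \<and> card U < \<alpha> \<and> insert v T \<subseteq> U} \<subseteq> \<W>"
          using less.prems(4) st(2) by (auto simp: \<W>_def)
      qed
      moreover have "var v \<in> N_cone V 1"
        using v residual_subset by (intro N_cone_var) auto
      ultimately have "certified V (1 + (\<alpha> ^ 2 + card \<W>)) (var v * (Q * g v))"
        by (rule certified_mult[rotated])
      then show ?thesis using \<U> by simp
    qed
    have rest: "certified V (\<alpha> ^ 2 + card \<U>) (Q * (const (real \<alpha>) * h))"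
    proof (rule certified_nonneg)
      have "Q * (const (real \<alpha>) * h) \<in> N_cone V (\<alpha> ^ 2 + card \<W> + 3)"
        using h by (intro N_cone_mult Q N_cone_const_mult) simp_all
      then show "Q * (const (real \<alpha>) * h) \<in> N_cone V (\<alpha> ^ 2 + card \<U> + 2)"
        using \<U> by (simp add: numeral_eq_Suc)
    qed
    have "certified V (\<alpha> ^ 2 + card \<U>) (Q * (linear_sum ?R * f))"
      unfolding split by (intro certified_add certified_sum step rest)
    moreover have "?m * (\<Prod>U\<in>\<U>. linear_sum (residual U)) * ?f = Q * (linear_sum ?R * f)"
      unfolding \<U>(1) prod.insert[OF \<U>(3,2)] Q_def f_def by (simp only: mult_ac)
    ultimately show ?thesis by simp
  qed
qed

end

section \<open>The rank bound\<close>

text \<open>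
  Members of \<open>H_cone\<close> are nonnegative on the nonnegative orthant. The multiplier can vanish at the
  indicator vector of \<open>S\<close>, but it is positive where all coordinates are positive, so the quadratic
  form is nonnegative there and, by continuity, at the indicator vector, where its value is
  \<open>s * card S - (card S)\<^sup>2\<close>.
\<close>

lemma nu_feasible_lower_bound:
  assumes V: "finite (pverts G)" and S: "S \<in> stable_sets G"
    and s: "s \<in> nu_feasible r G" and ne: "S \<noteq> {}"
  shows "real (card S) \<le> s"
proof -
  let ?V = "pverts G"
  let ?M = "\<lambda>i j. s * (adj_matrix G i j + identity_matrix i j) - all_ones_matrix i j"
  obtain p where p: "p \<in> N_cone ?V r" "norm1 p = 1" "p * quad_form ?V ?M \<in> H_cone ?V r"
    using s by (auto simp: nu_feasible_def Q_tilde_def)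
  have "p \<noteq> 0" using p(2) by (auto simp: norm1_def)
  \<comment> \<open>A path in the open orthant that tends to the indicator vector of \<open>S\<close> as \<open>e\<close> tends to \<open>0\<close>.\<close>
  define x where "x e i = (if i \<in> S then 1 else e)" for e :: real and i
  define q where "q e = (\<Sum>i\<in>?V. \<Sum>j\<in>?V. ?M i j * x e i * x e j)" for e
  have eval_q: "eval (x e) (quad_form ?V ?M) = q e" for e
    by (simp add: quad_form_def eval_sum eval_mult q_def)
  have nonneg: "q e \<ge> 0" if "e > 0" for e
  proof -
    have pos: "x e i > 0" for i using that by (simp add: x_def)
    have "eval (x e) p * q e \<ge> 0"
      using eval_H_cone_nonneg[OF p(3), of "x e"] pos by (simp add: eval_mult eval_q less_imp_le)
    moreover have "eval (x e) p > 0"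
      using eval_N_cone_pos[OF p(1) \<open>p \<noteq> 0\<close>] pos by blast
    ultimately show ?thesis by (simp add: zero_le_mult_iff)
  qed
  have "((\<lambda>e. x e i) \<longlongrightarrow> x 0 i) (at_right 0)" for i
    by (cases "i \<in> S") (simp_all add: x_def tendsto_ident_at)
  then have "(q \<longlongrightarrow> q 0) (at_right 0)"
    unfolding q_def by (intro tendsto_intros)
  then have "q 0 \<ge> 0"
    by (rule tendsto_lowerbound) (auto simp: eventually_at_right_less nonneg intro: eventually_mono[OF eventually_at_right_less])
  moreover have "q 0 = s * real (card S) - real (card S) ^ 2"
  proof -
    have SV: "S \<subseteq> ?V" using S by (simp add: stable_sets_def)
    then have fin: "finite S" using V finite_subset by blast
    have "q 0 = (\<Sum>i\<in>S. \<Sum>j\<in>S. ?M i j)"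
    proof -
      have "q 0 = (\<Sum>i\<in>S. \<Sum>j\<in>?V. ?M i j * x 0 i * x 0 j)"
        unfolding q_def by (rule sum.mono_neutral_right) (use V SV in \<open>auto simp: x_def\<close>)
      also have "\<dots> = (\<Sum>i\<in>S. \<Sum>j\<in>S. ?M i j)"
        by (rule sum.cong[OF refl], rule sum.mono_neutral_cong_right) (use V SV in \<open>auto simp: x_def\<close>)
      finally show ?thesis .
    qed
    also have "\<dots> = (\<Sum>i\<in>S. \<Sum>j\<in>S. (if i = j then s else 0) - 1)"
      using S by (intro sum.cong refl)
        (auto simp: stable_sets_def adj_matrix_def identity_matrix_def all_ones_matrix_def)
    also have "\<dots> = s * real (card S) - real (card S) ^ 2"
      using fin by (simp add: sum_subtractf power2_eq_square algebra_simps)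
    finally show ?thesis .
  qed
  ultimately have "real (card S) * real (card S) \<le> s * real (card S)"
    by (simp add: power2_eq_square)
  moreover have "card S > 0"
    using ne S V finite_subset by (auto simp: card_gt_0_iff stable_sets_def)
  ultimately show ?thesis by simp
qed

text \<open>
  For a polynomial with nonnegative coefficients the norm is the value at the all-ones vector, which
  is positive, so \<open>p\<close> can be rescaled to norm one.
\<close>

lemma certified_imp_Q_tilde:
  assumes V: "finite V" and M: "symmetric_on V M" and p: "p \<in> N_cone V r" "p \<noteq> 0"
    and cert: "certified V r (p * quad_form V M)"
  shows "M \<in> Q_tilde V r"
proof -
  define c where "c = eval (\<lambda>_. 1) p"
  have c: "c > 0"
    unfolding c_def using p by (rule eval_N_cone_pos) simp
  let ?p = "const (1 / c) * p"
  have N: "?p \<in> N_cone V r"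
    using p(1) c by (intro N_cone_const_mult) auto
  moreover have "norm1 ?p = 1"
    using norm1_eq_eval_one[OF N] c by (simp add: eval_mult flip: c_def)
  moreover have "certified V (0 + r) (const (1 / c) * (p * quad_form V M))"
    using c by (intro certified_mult cert N_cone_const) simp
  then have "?p * quad_form V M \<in> H_cone V r"
    using certified_imp_H_cone[OF V] by (simp add: mult.assoc)
  ultimately show ?thesis
    using M by (auto simp: Q_tilde_def)
qed

theorem proposition4p10:
  fixes G :: "'a pair_pre_digraph"
  assumes "pair_graph G"
  shows "nu_tilde_rank G
    \<le> enat ((stability_number G)^2 + 2 ^ stability_number G * card (max_stable_sets G))"
proof (cases "pverts G = {}")
  case True
  then show ?thesis by (simp add: nu_tilde_rank_def zero_enat_def)
next
  case False
  interpret pair_graph G by fact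
  define V where "V = pverts G"
  define \<alpha> where "\<alpha> = stability_number G"
  define E where "E u v \<longleftrightarrow> u = v \<or> (u, v) \<in> parcs G" for u v
  have finV: "finite V" by (simp add: V_def)
  have loops: "(u, u) \<notin> parcs G" for u using pair_no_loops[of "(u, u)"] by auto
  have sym: "(u, v) \<in> parcs G \<Longrightarrow> (v, u) \<in> parcs G" for u v
    using arcs_symmetric by auto
  have stable_iff: "U \<in> stable_sets G \<longleftrightarrow> U \<subseteq> V \<and> independent_in E U" for U
  proof -
    have "u \<noteq> v" if "(u, v) \<in> parcs G" for u v using loops that by auto
    then show ?thesis
      unfolding stable_sets_def independent_in_def pairwise_def E_def V_def by blast
  qed
  have fin: "finite (stable_sets G)"
    by (rule finite_subset[of _ "Pow V"]) (use finV in \<open>auto simp: stable_iff\<close>)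
  have card_le: "card U \<le> \<alpha>" if "U \<in> stable_sets G" for U
    unfolding \<alpha>_def stability_number_def using fin that by simp
  interpret reflexive_graph V E \<alpha>
  proof
    show "reflp E" "symp E"
      using sym by (auto simp: E_def intro!: reflpI sympI)
    show "card U \<le> \<alpha>" if "U \<subseteq> V" "independent_in E U" for U
      using card_le[of U] that by (simp add: stable_iff)
  qed (rule finV)
  have stable_eq: "stable U \<longleftrightarrow> U \<in> stable_sets G" for U
    by (simp add: stable_def stable_iff)
  have "{} \<in> stable_sets G" by (simp add: stable_sets_def)
  then have "\<alpha> \<in> card ` stable_sets G"
    unfolding \<alpha>_def stability_number_def using fin by (intro Max_in) auto
  then obtain S where S: "S \<in> stable_sets G" "card S = \<alpha>" by auto
  obtain v where "v \<in> V" using False by (auto simp: V_def)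
  then have "{v} \<in> stable_sets G" using loops by (simp add: stable_sets_def V_def)
  then have "\<alpha> > 0" using card_le[of "{v}"] by simp
  then have S_ne: "S \<noteq> {}" using S(2) by auto
  define \<U> where "\<U> = {U. extendable U \<and> card U < \<alpha>}"
  have \<U>_sub: "\<U> \<subseteq> (\<Union>S\<in>max_stable_sets G. Pow S)"
    by (auto simp: \<U>_def extendable_def stable_eq max_stable_sets_def simp flip: \<alpha>_def)
  have fin_max: "finite (max_stable_sets G)"
    using fin by (simp add: max_stable_sets_def)
  have fin_mem: "finite S" if "S \<in> max_stable_sets G" for S
    using that finite_stable by (simp add: max_stable_sets_def stable_eq)
  have finU: "finite \<U>"
    by (rule finite_subset[OF \<U>_sub]) (use fin_max fin_mem in auto)
  have "card \<U> \<le> card (\<Union>S\<in>max_stable_sets G. Pow S)"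
    by (rule card_mono[OF _ \<U>_sub]) (use fin_max fin_mem in auto)
  also have "\<dots> \<le> (\<Sum>S\<in>max_stable_sets G. card (Pow S))"
    by (rule card_UN_le[OF fin_max])
  also have "\<dots> = (\<Sum>S\<in>max_stable_sets G. 2 ^ \<alpha>)"
  proof (rule sum.cong[OF refl])
    fix S assume S: "S \<in> max_stable_sets G"
    then have "card S = \<alpha>" by (simp add: max_stable_sets_def \<alpha>_def)
    then show "card (Pow S) = 2 ^ \<alpha>" using card_Pow[OF fin_mem[OF S]] by simp
  qed
  also have "\<dots> = 2 ^ \<alpha> * card (max_stable_sets G)" by simp
  finally have card_U: "card \<U> \<le> 2 ^ \<alpha> * card (max_stable_sets G)" .
  define r where "r = \<alpha> ^ 2 + card \<U>"
  define p where "p = (linear_sum V ^ (\<alpha> ^ 2) * (\<Prod>U\<in>\<U>. linear_sum (residual U)) :: 'a mpoly)"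
  have pN: "p \<in> N_cone V r"
    using N_cone_mult[OF N_cone_power[OF linear_sum_N_cone[of V V], of "\<alpha> ^ 2"]
        N_cone_prod[of \<U> "\<lambda>U. linear_sum (residual U)" V "\<lambda>_. 1"]] linear_sum_N_cone[OF residual_subset]
    by (simp add: p_def r_def)
  \<comment> \<open>At the all-ones vector, \<open>p\<close> is a product of cardinalities of nonempty sets.\<close>
  have "eval (\<lambda>_. 1) (linear_sum A :: 'a mpoly) = real (card A)" for A
    by (simp add: linear_sum_def eval_sum)
  moreover have "card V \<noteq> 0" "\<And>U. U \<in> \<U> \<Longrightarrow> card (residual U) \<noteq> 0"
    using False finV residual_nonempty residual_subset finite_subset[OF residual_subset finV]
    by (auto simp: V_def \<U>_def)
  ultimately have "eval (\<lambda>_. 1) p \<noteq> 0"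
    using finU by (simp add: p_def eval_mult eval_power eval_prod)
  then have p0: "p \<noteq> 0" by auto
  let ?M = "\<lambda>i j. real \<alpha> * (adj_matrix G i j + identity_matrix i j) - all_ones_matrix i j"
  have quad: "quad_form V ?M = const (real \<alpha>) * edge_form V E - linear_sum V ^ 2"
  proof -
    have "?M i j = real \<alpha> * of_bool (E i j) - 1" for i j
      using loops by (simp add: adj_matrix_def identity_matrix_def all_ones_matrix_def E_def)
    moreover have "linear_sum V ^ 2 = (\<Sum>i\<in>V. \<Sum>j\<in>V. var i * var j :: 'a mpoly)"
      by (simp only: linear_sum_def power2_eq_square sum_product)
    ultimately show ?thesis
      by (simp add: quad_form_def edge_form_def
          sum_distrib_left const_diff const_mult left_diff_distrib sum_subtractf mult.assoc)
  qed
  have residual_empty: "residual {} = V" by (simp add: residual_def)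
  have "certified V (\<alpha> ^ 2 + card \<U>) (linear_sum V ^ (\<alpha> ^ 2) * (\<Prod>U\<in>\<U>. linear_sum (residual U)) *
    (const (real \<alpha>) * edge_form V (greedy_graph {} id) - linear_sum V ^ 2))"
    by (rule greedy_certificate)
      (use finU \<open>{} \<in> stable_sets G\<close> in \<open>simp_all add: stable_eq residual_empty \<U>_def\<close>)
  moreover have "edge_form V (greedy_graph {} id) = edge_form V E"
    by (rule edge_form_cong) (simp add: greedy_graph_def residual_empty)
  ultimately have "certified V r (p * quad_form V ?M)"
    by (simp add: quad p_def r_def)
  moreover have "symmetric_on V ?M"
    using sym by (auto simp: symmetric_on_def adj_matrix_def identity_matrix_def all_ones_matrix_def)
  ultimately have "?M \<in> Q_tilde V r"
    using certified_imp_Q_tilde[OF finV _ pN p0] by blast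
  then have feasible: "real \<alpha> \<in> nu_feasible r G"
    by (simp add: nu_feasible_def V_def)
  have "real \<alpha> \<le> s" if "s \<in> nu_feasible r G" for s
    using nu_feasible_lower_bound[OF _ S(1) that] S(2) S_ne finV by (simp add: V_def)
  with feasible have "is_nu_tilde r G (real (stability_number G))"
    unfolding is_nu_tilde_def \<alpha>_def by blast
  then have "nu_tilde_rank G \<le> enat r"
    unfolding nu_tilde_rank_def using False by (auto intro: Inf_lower)
  also have "\<dots> \<le> enat ((stability_number G)^2 + 2 ^ stability_number G * card (max_stable_sets G))"
    using card_U by (simp add: r_def \<alpha>_def)
  finally show ?thesis .
qed

end
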